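(* Let $P$ be a finite abelian $2$-group and let $2^a$ be its exponent. Then, for each integer $a_0\ge 1$ with $a_0\ge a-1$ and for each integer $\lambda\ge 1$, there exists a commutative local artinian ring $A$ such that $$A^*\cong\mathbb F_{2^\lambda}^*\times\mathbb Z/2\mathbb Z\times\mathbb Z/2^{a_0-1}\mathbb Z\times(\mathbb Z/2^{a_0}\mathbb Z)^{\lambda-1}\times P^\lambda.$$
   Context: $A^*$ denotes the group of units of a ring $A$ (rings have $1$), $\mathbb F_q$ is the finite field with $q$ elements, and $G^m$ is the direct product of $m$ copies of a group $G$ (trivial for $m=0$). *)

theory Defs
  imports "HOL-Algebra.Algebra"
begin

(* The zero ring is excluded: maximal ideals are proper. *)
locale local_cring = cring +
  assumes unique_maximalideal: "\<exists>!M. maximalideal M R"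

(* Descending chain condition on two-sided ideals; this is the notion of an artinian ring
   because R is commutative. *)
locale artinian_cring = cring +
  assumes descending_chain:
    "\<lbrakk>\<And>n. ideal (I n) R; \<And>n. I (Suc n) \<subseteq> I n\<rbrakk>
      \<Longrightarrow> \<exists>n. \<forall>m\<ge>n. I m = (I (n::nat) :: 'a set)"

(* Only meaningful for groups of finite exponent, in particular for finite groups. *)
definition group_exponent :: "('a, 'b) monoid_scheme \<Rightarrow> nat"
  where "group_exponent G = (LEAST n. 0 < n \<and> (\<forall>x\<in>carrier G. x [^]\<^bsub>G\<^esub> n = \<one>\<^bsub>G\<^esub>))"

definition group_power :: "('a, 'b) monoid_scheme \<Rightarrow> nat \<Rightarrow> (nat \<Rightarrow> 'a) monoid"
  where "group_power G m = product_group {..<m} (\<lambda>_. G)"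

end

theory Submission
  imports "HOL-Algebra.Algebraic_Closure_Type" Defs
begin

text \<open>
  The ring is the idealization of a Galois ring by a dual module. Let \<open>n = a0 + 1\<close> and let \<open>R\<close> be the
  Galois ring of characteristic \<open>2^n\<close> with residue field \<open>F\<close>: the quotient of the integer polynomials
  by \<open>(2^n, f)\<close>, where \<open>f\<close> is monic of degree \<open>l\<close> and reduces modulo two to the minimal polynomial of
  a generator of the multiplicative group of \<open>F\<close>. Additively \<open>R\<close> is free of rank \<open>l\<close> over the
  integers modulo \<open>2^n\<close>, and \<open>2^n\<close> kills \<open>P\<close> because \<open>a \<le> n\<close>. Hence the \<open>R\<close>-module \<open>M\<close> of additive
  homomorphisms from \<open>R\<close> to \<open>P\<close> is, as a group, \<open>P^l\<close> (\<open>hom_group_free_iso\<close>). The module axioms for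
  \<open>M\<close> are immediate, and no decomposition of \<open>P\<close> into cyclic groups is needed. The idealization \<open>A\<close> of
  \<open>M\<close> is a finite local ring with residue field \<open>F\<close>, and its unit group is the product of the unit
  group of \<open>R\<close> and the additive group \<open>M\<close> (\<open>units_hom_idealization_iso\<close>).

  It remains to find the units of \<open>R\<close> (\<open>units_galois_ring_iso\<close>). The Teichmueller lift splits off the
  unit group of \<open>F\<close>. The principal units, those congruent to \<open>1\<close> modulo two, are generated by \<open>-1\<close>,
  by \<open>1 + 4 v\<^sub>0\<close> with \<open>v\<^sub>0\<close> outside the image of \<open>w \<mapsto> w + w\<^sup>2\<close> on \<open>F\<close>, and by \<open>1 + 2 b\<close> with \<open>b\<close> running
  through the lifts of the \<open>l - 1\<close> further elements of a basis of \<open>F\<close> that starts with \<open>1\<close>. This is an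
  approximation along powers of two (\<open>unit_filtration\<close>), based on the identity
  \<open>(1 + 2 w)\<^sup>2 = 1 + 4 (w + w\<^sup>2)\<close>. The orders of these generators divide \<open>2\<close>, \<open>2^(n-2)\<close> and \<open>2^(n-1)\<close>.
  The product of the cyclic groups of these orders has as many elements as the group of principal
  units, so the surjection from this product is an isomorphism.
\<close>

(* The order of a group is meant, not the multiplicity of a root. *)
hide_const (open) Polynomial.order

(* The dot is used for integer multiples only. *)
no_notation ideal_prod (infixl "\<cdot>\<index>" 80)

section \<open>Congruences modulo a power of two and one further element\<close>


text \<open>The ideal \<open>(2^k, f)\<close> of a commutative ring. It is studied for an arbitrary ring type; the
  application has integer polynomials and a monic \<open>f\<close>.\<close>

definition two_pow_ideal :: "'a::comm_ring_1 \<Rightarrow> nat \<Rightarrow> 'a set"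
  where "two_pow_ideal f k = {2 ^ k * s + f * t | s t. True}"

lemma two_pow_idealI: "x = 2 ^ k * s + f * t \<Longrightarrow> x \<in> two_pow_ideal f k"
  by (auto simp: two_pow_ideal_def)

lemma two_pow_idealE:
  assumes "x \<in> two_pow_ideal f k" obtains s t where "x = 2 ^ k * s + f * t"
  using assms by (auto simp: two_pow_ideal_def)

lemma two_pow_ideal_zero [simp]: "0 \<in> two_pow_ideal f k"
  by (rule two_pow_idealI[where s = 0 and t = 0]) simp

lemma two_pow_ideal_add:
  assumes "x \<in> two_pow_ideal f k" "y \<in> two_pow_ideal f k"
  shows "x + y \<in> two_pow_ideal f k"
proof -
  obtain s t s' t' where "x = 2 ^ k * s + f * t" "y = 2 ^ k * s' + f * t'"
    using assms by (meson two_pow_idealE)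
  then show ?thesis
    by (intro two_pow_idealI[where s = "s + s'" and t = "t + t'"]) (simp add: algebra_simps)
qed

lemma two_pow_ideal_mult:
  assumes "x \<in> two_pow_ideal f k"
  shows "r * x \<in> two_pow_ideal f k"
proof -
  obtain s t where "x = 2 ^ k * s + f * t" using assms by (meson two_pow_idealE)
  then show ?thesis
    by (intro two_pow_idealI[where s = "r * s" and t = "r * t"]) (simp add: algebra_simps)
qed

lemma two_pow_ideal_mult_right: "x \<in> two_pow_ideal f k \<Longrightarrow> x * r \<in> two_pow_ideal f k"
  using two_pow_ideal_mult[of x f k r] by (simp add: mult.commute)

lemma two_pow_ideal_uminus: "x \<in> two_pow_ideal f k \<Longrightarrow> - x \<in> two_pow_ideal f k"
  using two_pow_ideal_mult[of x f k "-1"] by simp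

lemma two_pow_ideal_antimono:
  assumes "k \<le> m" "x \<in> two_pow_ideal f m" shows "x \<in> two_pow_ideal f k"
proof -
  obtain s t where "x = 2 ^ m * s + f * t" using assms by (meson two_pow_idealE)
  then show ?thesis using \<open>k \<le> m\<close>
    by (intro two_pow_idealI[where s = "2 ^ (m - k) * s" and t = t])
       (simp flip: power_add mult.assoc)
qed

lemma two_pow_ideal_shift:
  assumes "x \<in> two_pow_ideal f k" shows "2 ^ j * x \<in> two_pow_ideal f (k + j)"
proof -
  obtain s t where "x = 2 ^ k * s + f * t" using assms by (meson two_pow_idealE)
  then show ?thesis
    by (intro two_pow_idealI[where s = s and t = "2 ^ j * t"])
       (simp add: algebra_simps power_add)
qed

lemma two_pow_mem: "k \<le> m \<Longrightarrow> 2 ^ m * y \<in> two_pow_ideal f k"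
  by (rule two_pow_ideal_antimono[of k m], assumption)
     (rule two_pow_idealI[where s = y and t = 0], simp)

text \<open>Congruence modulo \<open>(2^k, f)\<close>.\<close>

definition two_pow_cong :: "'a::comm_ring_1 \<Rightarrow> nat \<Rightarrow> 'a \<Rightarrow> 'a \<Rightarrow> bool"
  where "two_pow_cong f k x y \<longleftrightarrow> x - y \<in> two_pow_ideal f k"

lemma two_pow_cong_refl [simp]: "two_pow_cong f k x x"
  by (simp add: two_pow_cong_def)

lemma two_pow_cong_sym: "two_pow_cong f k x y \<Longrightarrow> two_pow_cong f k y x"
  unfolding two_pow_cong_def using two_pow_ideal_uminus[of "x - y" f k] by simp

lemma two_pow_cong_trans [trans]:
  "two_pow_cong f k x y \<Longrightarrow> two_pow_cong f k y z \<Longrightarrow> two_pow_cong f k x z"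
  unfolding two_pow_cong_def using two_pow_ideal_add[of "x - y" f k "y - z"] by simp

lemma two_pow_cong_mult:
  assumes "two_pow_cong f k x y" "two_pow_cong f k u v"
  shows "two_pow_cong f k (x * u) (y * v)"
proof -
  have "u * (x - y) + y * (u - v) \<in> two_pow_ideal f k"
    using assms unfolding two_pow_cong_def by (intro two_pow_ideal_add two_pow_ideal_mult)
  then show ?thesis by (simp add: two_pow_cong_def algebra_simps)
qed

lemma two_pow_cong_add:
  assumes "two_pow_cong f k x y" "two_pow_cong f k u v"
  shows "two_pow_cong f k (x + u) (y + v)"
  using two_pow_ideal_add[of "x - y" f k "u - v"] assms
  by (simp add: two_pow_cong_def algebra_simps)

lemma two_pow_cong_sum:
  "(\<And>i. i \<in> A \<Longrightarrow> two_pow_cong f k (g i) (h i)) \<Longrightarrow> two_pow_cong f k (sum g A) (sum h A)"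
  by (induction A rule: infinite_finite_induct) (auto intro: two_pow_cong_add)

lemma two_pow_cong_power: "two_pow_cong f k x y \<Longrightarrow> two_pow_cong f k (x ^ m) (y ^ m)"
  by (induction m) (auto intro: two_pow_cong_mult)

lemma two_pow_cong_antimono:
  "k \<le> m \<Longrightarrow> two_pow_cong f m x y \<Longrightarrow> two_pow_cong f k x y"
  unfolding two_pow_cong_def by (rule two_pow_ideal_antimono)

lemma two_pow_cong_scale:
  "two_pow_cong f k x y \<Longrightarrow> two_pow_cong f (k + j) (2 ^ j * x) (2 ^ j * y)"
  unfolding two_pow_cong_def using two_pow_ideal_shift[of "x - y" f k j]
  by (simp add: algebra_simps)

text \<open>Squaring gains one power of two, because \<open>x\<^sup>2 - y\<^sup>2 = 2 * y * (x - y) + (x - y)\<^sup>2\<close>. Iterated, it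
  bounds the exponent of the group of principal units and makes the Teichmueller lift well defined.\<close>

lemma two_pow_cong_square:
  assumes "two_pow_cong f k x y" "k \<ge> 1"
  shows "two_pow_cong f (Suc k) (x\<^sup>2) (y\<^sup>2)"
proof -
  obtain s t where st: "x - y = 2 ^ k * s + f * t"
    using assms by (auto simp: two_pow_cong_def elim: two_pow_idealE)
  have "2 ^ 1 * (y * (x - y)) \<in> two_pow_ideal f (k + 1)"
    using assms by (intro two_pow_ideal_shift two_pow_ideal_mult) (simp add: two_pow_cong_def)
  moreover have "2 ^ (k + k) * s\<^sup>2 \<in> two_pow_ideal f (k + 1)"
    using assms by (intro two_pow_mem) simp
  moreover have "f * (2 * 2 ^ k * s * t + f * t\<^sup>2) \<in> two_pow_ideal f (k + 1)"
    by (rule two_pow_idealI[where s = 0]) simp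
  ultimately have "2 ^ 1 * (y * (x - y)) + (2 ^ (k + k) * s\<^sup>2 + f * (2 * 2 ^ k * s * t + f * t\<^sup>2))
      \<in> two_pow_ideal f (k + 1)"
    by (intro two_pow_ideal_add)
  moreover have "2 ^ (k + k) * s\<^sup>2 + f * (2 * 2 ^ k * s * t + f * t\<^sup>2) = (x - y)\<^sup>2"
    unfolding st by (simp add: algebra_simps power2_eq_square power_add)
  moreover have "2 ^ 1 * (y * (x - y)) + (x - y)\<^sup>2 = x\<^sup>2 - y\<^sup>2"
    by (simp add: algebra_simps power2_eq_square)
  ultimately show ?thesis by (simp add: two_pow_cong_def)
qed

lemma two_pow_cong_power_two_pow:
  assumes "two_pow_cong f k x y" "k \<ge> 1"
  shows "two_pow_cong f (k + j) (x ^ 2 ^ j) (y ^ 2 ^ j)"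
proof (induction j)
  case 0
  show ?case using assms by simp
next
  case (Suc j)
  from two_pow_cong_square[OF this] show ?case
    using assms(2) by (simp add: power_mult[symmetric] mult.commute)
qed

lemma one_plus_power_two_pow:
  assumes "k \<ge> 2"
  shows "two_pow_cong f (Suc (k + j)) ((1 + 2 ^ k * y) ^ 2 ^ j) (1 + 2 ^ (k + j) * y)"
proof (induction j)
  case 0
  show ?case by simp
next
  case (Suc j)
  have "two_pow_cong f (Suc (Suc (k + j))) (((1 + 2 ^ k * y) ^ 2 ^ j)\<^sup>2) ((1 + 2 ^ (k + j) * y)\<^sup>2)"
    using two_pow_cong_square[OF Suc] by simp
  also have "(1 + 2 ^ (k + j) * y)\<^sup>2 = 1 + 2 ^ (k + Suc j) * y + 2 ^ (k + j + (k + j)) * y\<^sup>2"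
    by (simp add: algebra_simps power2_eq_square power_add)
  also have "two_pow_cong f (Suc (Suc (k + j))) \<dots> (1 + 2 ^ (k + Suc j) * y)"
    using assms by (simp add: two_pow_cong_def two_pow_mem)
  finally show ?case by (simp add: power_mult[symmetric] mult.commute)
qed

text \<open>The first squaring of \<open>1 + 2 * w\<close> produces \<open>w + w\<^sup>2\<close> instead of \<open>w\<close>: the Artin--Schreier map
  of the residue field is the reason why one cyclic factor of the unit group is shorter by one and
  why \<open>-1\<close> splits off.\<close>

lemma one_plus_two_power_two_pow:
  "two_pow_cong f (3 + j) ((1 + 2 * w) ^ 2 ^ Suc j) (1 + 2 ^ (2 + j) * (w + w\<^sup>2))"
proof -
  have "(1 + 2 * w) ^ 2 ^ Suc j = ((1 + 2 * w)\<^sup>2) ^ 2 ^ j"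
    by (simp add: power_mult[symmetric])
  also have "(1 + 2 * w)\<^sup>2 = 1 + 2 ^ 2 * (w + w\<^sup>2)"
    by (simp add: algebra_simps power2_eq_square)
  finally show ?thesis
    using one_plus_power_two_pow[of 2 f j "w + w\<^sup>2"] by (simp add: numeral_3_eq_3)
qed

lemma prod_one_plus_two_cong:
  assumes "finite I"
  shows "two_pow_cong f 2 (\<Prod>i\<in>I. 1 + 2 * g i) (1 + 2 * (\<Sum>i\<in>I. g i))"
  using assms
proof (induction I)
  case empty
  show ?case by simp
next
  case (insert i I)
  have "two_pow_cong f 2 (\<Prod>i\<in>insert i I. 1 + 2 * g i) ((1 + 2 * g i) * (1 + 2 * sum g I))"
    using insert by (auto intro: two_pow_cong_mult)
  also have "(1 + 2 * g i) * (1 + 2 * sum g I) =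
      1 + 2 * (g i + sum g I) + 2 ^ 2 * (g i * sum g I)"
    by (simp add: algebra_simps)
  also have "two_pow_cong f 2 \<dots> (1 + 2 * (g i + sum g I))"
    using two_pow_mem[of 2 2 "g i * sum g I" f] by (simp add: two_pow_cong_def)
  finally show ?case using insert by simp
qed

text \<open>Generators of the group of principal units. Let \<open>b\<close> span the residue ring over the prime field,
  and let \<open>v\<^sub>0\<close> represent the cokernel of \<open>w \<mapsto> w + w\<^sup>2\<close> there. A set \<open>H\<close> of principal units that is
  closed under products and contains \<open>1\<close>, all \<open>1 + 2 * b i\<close> and \<open>1 + 4 * v\<^sub>0\<close> approximates every principal
  unit modulo every power of two. By induction on \<open>k\<close> it suffices to reach each \<open>1 + 2^k * v\<close> modulo
  \<open>2^(k+1)\<close>; for \<open>k = 1\<close> this is the spanning hypothesis, and for \<open>k \<ge> 2\<close> one takes powers of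
  \<open>1 + 4 * v\<^sub>0\<close> and of elements reached at level one.\<close>

lemma unit_filtration:
  fixes f v\<^sub>0 x :: "'a::comm_ring_1" and b :: "'i \<Rightarrow> 'a"
  assumes fin: "finite I"
    and one: "1 \<in> H" and mult: "\<And>x y. x \<in> H \<Longrightarrow> y \<in> H \<Longrightarrow> x * y \<in> H"
    and gens: "1 + 4 * v\<^sub>0 \<in> H" "\<And>i. i \<in> I \<Longrightarrow> 1 + 2 * b i \<in> H"
    and principal: "\<And>h. h \<in> H \<Longrightarrow> two_pow_cong f 1 h 1"
    and span: "\<And>v. \<exists>J\<subseteq>I. two_pow_cong f 1 v (\<Sum>i\<in>J. b i)"
    and artin_schreier: "\<And>v. \<exists>c w. two_pow_cong f 1 v (of_nat c * v\<^sub>0 + (w + w\<^sup>2))"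
    and x: "two_pow_cong f 1 x 1"
  shows "\<exists>h\<in>H. two_pow_cong f (Suc k) x h"
proof -
  have pow: "h ^ m \<in> H" if "h \<in> H" for h and m :: nat
    using that by (induction m) (auto intro: one mult)
  have prodH: "(\<Prod>i\<in>J. g i) \<in> H" if "\<And>i. i \<in> J \<Longrightarrow> g i \<in> H" for g and J :: "'i set"
    using that by (induction J rule: infinite_finite_induct) (auto intro: one mult)
  have layer1: "\<exists>h\<in>H. two_pow_cong f 2 (1 + 2 * v) h" for v
  proof -
    obtain J where J: "J \<subseteq> I" "two_pow_cong f 1 v (\<Sum>i\<in>J. b i)"
      using span by blast
    have "two_pow_cong f 2 (1 + 2 * v) (1 + 2 * (\<Sum>i\<in>J. b i))"
      using two_pow_cong_scale[OF J(2), of 1]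
      by (intro two_pow_cong_add) (auto simp: numeral_2_eq_2)
    also have "two_pow_cong f 2 \<dots> (\<Prod>i\<in>J. 1 + 2 * b i)"
      using J fin by (intro two_pow_cong_sym[OF prod_one_plus_two_cong])
        (auto intro: finite_subset)
    finally have "two_pow_cong f 2 (1 + 2 * v) (\<Prod>i\<in>J. 1 + 2 * b i)" .
    moreover have "(\<Prod>i\<in>J. 1 + 2 * b i) \<in> H"
      using J gens by (intro prodH) auto
    ultimately show ?thesis by blast
  qed
  have layer: "\<exists>h\<in>H. two_pow_cong f (Suc (Suc k)) (1 + 2 ^ Suc k * v) h" for k v
  proof (cases k)
    case 0
    then show ?thesis using layer1[of v] by (simp add: numeral_2_eq_2)
  next
    case (Suc j)
    obtain c w where cw: "two_pow_cong f 1 v (of_nat c * v\<^sub>0 + (w + w\<^sup>2))"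
      using artin_schreier by blast
    obtain h where h: "h \<in> H" "two_pow_cong f 2 (1 + 2 * w) h" using layer1 by blast
    let ?u = "(1 + 4 * v\<^sub>0) ^ 2 ^ j" and ?K = "3 + j"
    have u: "two_pow_cong f ?K (?u ^ c) ((1 + 2 ^ (2 + j) * v\<^sub>0) ^ c)"
      using one_plus_power_two_pow[of 2 f j v\<^sub>0]
      by (intro two_pow_cong_power) (simp add: numeral_3_eq_3)
    have u': "two_pow_cong f ?K ((1 + 2 ^ (2 + j) * v\<^sub>0) ^ c) (1 + 2 ^ (2 + j) * (of_nat c * v\<^sub>0))" for c
    proof (induction c)
      case 0
      show ?case by simp
    next
      case (Suc c)
      have "two_pow_cong f ?K ((1 + 2 ^ (2 + j) * v\<^sub>0) ^ Suc c)
          ((1 + 2 ^ (2 + j) * v\<^sub>0) * (1 + 2 ^ (2 + j) * (of_nat c * v\<^sub>0)))"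
        using Suc by (auto intro: two_pow_cong_mult)
      also have "(1 + 2 ^ (2 + j) * v\<^sub>0) * (1 + 2 ^ (2 + j) * (of_nat c * v\<^sub>0)) =
          1 + 2 ^ (2 + j) * (of_nat (Suc c) * v\<^sub>0) + 2 ^ ((2 + j) + (2 + j)) * (of_nat c * v\<^sub>0\<^sup>2)"
        by (simp add: algebra_simps power_add power2_eq_square)
      also have "two_pow_cong f ?K \<dots> (1 + 2 ^ (2 + j) * (of_nat (Suc c) * v\<^sub>0))"
        using two_pow_mem[of ?K "(2 + j) + (2 + j)" "of_nat c * v\<^sub>0\<^sup>2" f]
        unfolding two_pow_cong_def by simp
      finally show ?case .
    qed
    have "two_pow_cong f ?K (h ^ 2 ^ Suc j) ((1 + 2 * w) ^ 2 ^ Suc j)"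
      using two_pow_cong_power_two_pow[OF two_pow_cong_sym[OF h(2)], of "Suc j"]
      by (simp add: numeral_3_eq_3)
    also have "two_pow_cong f ?K \<dots> (1 + 2 ^ (2 + j) * (w + w\<^sup>2))"
      by (rule one_plus_two_power_two_pow)
    finally have "two_pow_cong f ?K (?u ^ c * h ^ 2 ^ Suc j)
        ((1 + 2 ^ (2 + j) * (of_nat c * v\<^sub>0)) * (1 + 2 ^ (2 + j) * (w + w\<^sup>2)))"
      using two_pow_cong_trans[OF u u'] by (intro two_pow_cong_mult)
    also have "(1 + 2 ^ (2 + j) * (of_nat c * v\<^sub>0)) * (1 + 2 ^ (2 + j) * (w + w\<^sup>2)) =
        1 + 2 ^ (2 + j) * (of_nat c * v\<^sub>0 + (w + w\<^sup>2))
          + 2 ^ ((2 + j) + (2 + j)) * (of_nat c * v\<^sub>0 * (w + w\<^sup>2))"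
      by (simp add: algebra_simps power_add)
    also have "two_pow_cong f ?K \<dots> (1 + 2 ^ (2 + j) * (of_nat c * v\<^sub>0 + (w + w\<^sup>2)))"
      using two_pow_mem[of ?K "(2 + j) + (2 + j)" "of_nat c * v\<^sub>0 * (w + w\<^sup>2)" f]
      unfolding two_pow_cong_def by simp
    also have "two_pow_cong f ?K \<dots> (1 + 2 ^ (2 + j) * v)"
      using two_pow_cong_scale[OF two_pow_cong_sym[OF cw], of "2 + j"]
      by (intro two_pow_cong_add) (auto simp: numeral_3_eq_3)
    finally have "two_pow_cong f ?K (1 + 2 ^ (2 + j) * v) (?u ^ c * h ^ 2 ^ Suc j)"
      by (rule two_pow_cong_sym)
    moreover have "?u ^ c * h ^ 2 ^ Suc j \<in> H"
      using h gens by (intro mult pow)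
    ultimately show ?thesis using Suc by (auto simp: numeral_3_eq_3)
  qed
  \<comment> \<open>Correct an approximation \<open>h\<close> by a factor \<open>1 + 2 ^ Suc k * v\<close>; since \<open>h\<close> is principal, this adds
    just \<open>2 ^ Suc k * v\<close> modulo the next power.\<close>
  show ?thesis
  proof (induction k)
    case 0
    show ?case using x one by auto
  next
    case (Suc k)
    then obtain h where h: "h \<in> H" "two_pow_cong f (Suc k) x h" by blast
    then obtain v t where vt: "x - h = 2 ^ Suc k * v + f * t"
      by (auto simp: two_pow_cong_def elim: two_pow_idealE)
    obtain h' where h': "h' \<in> H" "two_pow_cong f (Suc (Suc k)) (1 + 2 ^ Suc k * v) h'"
      using layer by blast
    have "x - (h + 2 ^ Suc k * v) = 2 ^ Suc (Suc k) * 0 + f * t"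
      using vt by (simp add: algebra_simps)
    then have "two_pow_cong f (Suc (Suc k)) x (h + 2 ^ Suc k * v)"
      unfolding two_pow_cong_def by (rule two_pow_idealI)
    also have "two_pow_cong f (Suc (Suc k)) \<dots> (h + 2 ^ Suc k * (h * v))"
      using two_pow_cong_scale[OF two_pow_cong_mult[OF two_pow_cong_sym[OF principal[OF h(1)]]
          two_pow_cong_refl[of f 1 v]], of "Suc k"]
      by (intro two_pow_cong_add) auto
    also have "h + 2 ^ Suc k * (h * v) = h * (1 + 2 ^ Suc k * v)"
      by (simp add: algebra_simps)
    also have "two_pow_cong f (Suc (Suc k)) \<dots> (h * h')"
      using h'(2) by (intro two_pow_cong_mult) auto
    finally show ?case using mult[OF h(1) h'(1)] by blast
  qed
qed

section \<open>Normal forms modulo two powers and a monic polynomial\<close>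

lemma two_power_poly: "(2 :: int poly) ^ k = [:2 ^ k:]"
  by (simp add: numeral_poly flip: poly_const_pow)

lemma coeff_two_power_mult: "Polynomial.coeff (2 ^ k * p :: int poly) i = 2 ^ k * Polynomial.coeff p i"
  by (simp add: two_power_poly)

lemma monic_division:
  fixes f p :: "int poly"
  assumes "lead_coeff f = 1" "Polynomial.degree f > 0"
  shows "\<exists>q r. p = f * q + r \<and> Polynomial.degree r < Polynomial.degree f"
proof (induction "Polynomial.degree p" arbitrary: p rule: less_induct)
  case less
  show ?case
  proof (cases "Polynomial.degree p < Polynomial.degree f")
    case True
    then show ?thesis by (intro exI[of _ 0] exI[of _ p]) simp
  next
    case False
    define m where "m = Polynomial.monom (lead_coeff p) (Polynomial.degree p - Polynomial.degree f)"
    have "p \<noteq> 0" using False assms by auto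
    then have "m \<noteq> 0" by (simp add: m_def)
    have f0: "f \<noteq> 0" using assms by auto
    have deg: "Polynomial.degree (f * m) = Polynomial.degree p"
      using False \<open>p \<noteq> 0\<close> \<open>m \<noteq> 0\<close> f0 by (simp add: degree_mult_eq m_def Polynomial.degree_monom_eq)
    have lead: "Polynomial.coeff (f * m) (Polynomial.degree p) = lead_coeff p"
      using deg assms(1) \<open>p \<noteq> 0\<close> lead_coeff_mult[of f m] unfolding deg
      by (simp add: m_def Polynomial.degree_monom_eq)
    have "Polynomial.degree p > 0" using False assms by simp
    then have "Polynomial.degree (p - f * m) < Polynomial.degree p"
      using deg lead by (metis diff_self coeff_diff degree_diff_le degree_0 leading_coeff_0_iff
          le_neq_implies_less order_refl)
    from less[OF this] obtain q r where "p - f * m = f * q + r" "Polynomial.degree r < Polynomial.degree f"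
      by blast
    then show ?thesis
      by (intro exI[of _ "q + m"] exI[of _ r]) (simp add: algebra_simps)
  qed
qed

text \<open>After division of the cofactor of \<open>2 ^ k\<close> by \<open>f\<close>, the multiple of \<open>f\<close> that remains has degree less
  than that of \<open>f\<close> and vanishes.\<close>

lemma small_degree_two_pow_ideal:
  fixes f r :: "int poly"
  assumes f: "lead_coeff f = 1" "Polynomial.degree f > 0"
    and r: "r \<in> two_pow_ideal f k" "Polynomial.degree r < Polynomial.degree f"
  shows "2 ^ k dvd Polynomial.coeff r i"
proof -
  obtain s t where st: "r = 2 ^ k * s + f * t" using r by (meson two_pow_idealE)
  obtain q s' where s': "s = f * q + s'" "Polynomial.degree s' < Polynomial.degree f"
    using monic_division[OF f] by blast
  have eq: "r - 2 ^ k * s' = f * (t + 2 ^ k * q)" unfolding st s' by (simp add: algebra_simps)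
  have "Polynomial.degree (r - 2 ^ k * s') < Polynomial.degree f"
    using r s' by (intro degree_diff_less) (auto simp: two_power_poly)
  then have "t + 2 ^ k * q = 0"
    unfolding eq using f by (metis degree_mult_right_le degree_0 mult_zero_right not_le less_irrefl)
  then have "r = 2 ^ k * s'" using eq by simp
  then show ?thesis by (simp add: coeff_two_power_mult)
qed

text \<open>The representatives for integer polynomials modulo \<open>(2^k, f)\<close>, with \<open>f\<close> monic of degree \<open>l\<close>:
  degree less than \<open>l\<close> and coefficients between \<open>0\<close> and \<open>2^k - 1\<close>. The degree bound is phrased by
  coefficients, so that it also makes sense for \<open>l = 0\<close>.\<close>

definition normal_forms :: "nat \<Rightarrow> nat \<Rightarrow> int poly set"
  where "normal_forms l k =
    {r. (\<forall>i\<ge>l. Polynomial.coeff r i = 0) \<and> (\<forall>i. Polynomial.coeff r i \<in> {0..<2 ^ k})}"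

text \<open>The polynomial whose first \<open>l\<close> coefficients are given by \<open>c\<close>.\<close>

definition poly_of_coeffs :: "nat \<Rightarrow> (nat \<Rightarrow> int) \<Rightarrow> int poly"
  where "poly_of_coeffs l c = (\<Sum>i<l. Polynomial.monom (c i) i)"

lemma coeff_poly_of_coeffs:
  "Polynomial.coeff (poly_of_coeffs l c) i = (if i < l then c i else 0)"
  by (simp add: poly_of_coeffs_def Polynomial.coeff_sum Polynomial.coeff_monom sum.delta)

lemma bij_betw_normal_forms:
  "bij_betw (poly_of_coeffs l) ({..<l} \<rightarrow>\<^sub>E {0..<2 ^ k}) (normal_forms l k)"
proof (rule bij_betwI[where g = "\<lambda>r. restrict (Polynomial.coeff r) {..<l}"])
  show "poly_of_coeffs l \<in> ({..<l} \<rightarrow>\<^sub>E {0..<2 ^ k}) \<rightarrow> normal_forms l k"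
    by (auto simp: normal_forms_def coeff_poly_of_coeffs PiE_iff)
  show "(\<lambda>r. restrict (Polynomial.coeff r) {..<l}) \<in> normal_forms l k \<rightarrow> ({..<l} \<rightarrow>\<^sub>E {0..<2 ^ k})"
    by (auto simp: normal_forms_def)
  show "restrict (Polynomial.coeff (poly_of_coeffs l c)) {..<l} = c"
    if "c \<in> {..<l} \<rightarrow>\<^sub>E {0..<2 ^ k}" for c
    using that by (fastforce simp: coeff_poly_of_coeffs PiE_iff extensional_def)
  show "poly_of_coeffs l (restrict (Polynomial.coeff r) {..<l}) = r"
    if "r \<in> normal_forms l k" for r
    using that by (intro poly_eqI) (auto simp: coeff_poly_of_coeffs normal_forms_def)
qed

lemma card_normal_forms: "card (normal_forms l k) = 2 ^ (k * l)"
  and finite_normal_forms: "finite (normal_forms l k)"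
proof -
  have "card (normal_forms l k) = card ({..<l} \<rightarrow>\<^sub>E {0..<2 ^ k :: int})"
    using bij_betw_same_card[OF bij_betw_normal_forms] by metis
  also have "\<dots> = 2 ^ (k * l)" by (simp add: card_PiE power_mult nat_power_eq)
  finally show *: "card (normal_forms l k) = 2 ^ (k * l)" .
  show "finite (normal_forms l k)" by (rule card_ge_0_finite) (simp add: *)
qed

lemma ex_normal_form:
  fixes f p :: "int poly"
  assumes f: "lead_coeff f = 1" "Polynomial.degree f = l" "l > 0"
  shows "\<exists>r\<in>normal_forms l k. two_pow_cong f k p r"
proof -
  obtain q r where qr: "p = f * q + r" "Polynomial.degree r < Polynomial.degree f"
    using monic_division[of f p] f by auto
  define r' where "r' = poly_of_coeffs l (\<lambda>i. Polynomial.coeff r i mod 2 ^ k)"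
  define s where "s = poly_of_coeffs l (\<lambda>i. Polynomial.coeff r i div 2 ^ k)"
  have "r = 2 ^ k * s + r'"
  proof (rule poly_eqI)
    fix i
    show "Polynomial.coeff r i = Polynomial.coeff (2 ^ k * s + r') i"
      using qr(2) f by (auto simp: coeff_two_power_mult r'_def s_def coeff_poly_of_coeffs coeff_eq_0)
  qed
  then have "p - r' = 2 ^ k * s + f * q" using qr by simp
  then have "two_pow_cong f k p r'" unfolding two_pow_cong_def by (rule two_pow_idealI)
  moreover have "r' \<in> normal_forms l k"
    by (auto simp: normal_forms_def r'_def coeff_poly_of_coeffs)
  ultimately show ?thesis by blast
qed

lemma degree_normal_form: "r \<in> normal_forms l k \<Longrightarrow> l > 0 \<Longrightarrow> Polynomial.degree r < l"
  unfolding normal_forms_def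
  by (metis (mono_tags, lifting) degree_0 leading_coeff_0_iff mem_Collect_eq not_le)

lemma normal_form_unique:
  fixes f :: "int poly"
  assumes f: "lead_coeff f = 1" "Polynomial.degree f = l" "l > 0"
    and "r \<in> normal_forms l k" "r' \<in> normal_forms l k" "two_pow_cong f k r r'"
  shows "r = r'"
proof (rule poly_eqI)
  fix i
  have "2 ^ k dvd Polynomial.coeff (r - r') i"
    using assms degree_normal_form[of r l k] degree_normal_form[of r' l k]
    by (intro small_degree_two_pow_ideal[of f]) (auto simp: two_pow_cong_def intro: degree_diff_less)
  then have "Polynomial.coeff r i mod 2 ^ k = Polynomial.coeff r' i mod 2 ^ k"
    by (simp add: mod_eq_dvd_iff)
  then show "Polynomial.coeff r i = Polynomial.coeff r' i"
    using assms by (auto simp: normal_forms_def)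
qed


section \<open>Finite fields of characteristic two\<close>

lemma (in group_hom) card_image_times_kernel:
  assumes "finite (carrier G)"
  shows "card (h ` carrier G) * card (kernel G H h) = order G"
proof -
  have "(\<lambda>C. the_elem (h ` C)) ` carrier (G Mod kernel G H h) = h ` carrier G"
  proof -
    have "the_elem (h ` (kernel G H h #> g)) = h g" if "g \<in> carrier G" for g
      using that G.rcos_self[OF that subgroup_kernel]
      by (intro the_elem_image_unique) (auto simp: kernel_def r_coset_def)
    then show ?thesis by (force simp: FactGroup_def RCOSETS_def)
  qed
  then have "card (carrier (G Mod kernel G H h)) = card (h ` carrier G)"
    using card_image[OF FactGroup_inj_on] by metis
  moreover have "carrier (G Mod kernel G H h) = rcosets\<^bsub>G\<^esub> kernel G H h"
    by (simp add: FactGroup_def)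
  ultimately show ?thesis
    using G.lagrange[OF subgroup_kernel] by (simp add: mult.commute)
qed

lemma (in field) char_two_of_order:
  assumes "order R = 2 ^ l"
  shows "\<one> \<oplus> \<one> = \<zero>"
proof -
  have fin: "finite (carrier R)" using assms by (metis card_ge_0_finite Coset.order_def zero_less_numeral zero_less_power)
  have eq: "[(2 ^ l :: nat)] \<cdot> \<one> = (\<one> \<oplus> \<one>) [^] l" for l :: nat
  proof (induction l)
    case 0
    show ?case by simp
  next
    case (Suc l)
    have "[(2 ^ Suc l :: nat)] \<cdot> \<one> = [(2 ^ l :: nat)] \<cdot> \<one> \<oplus> [(2 ^ l :: nat)] \<cdot> \<one>"
      by (simp add: add.nat_pow_mult mult_2)
    also have "\<dots> = (\<one> \<oplus> \<one>) [^] l \<otimes> (\<one> \<oplus> \<one>)"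
      unfolding Suc by (simp add: r_distr)
    finally show ?case by simp
  qed
  have "[order R] \<cdot> \<one> = \<zero>"
    using add.pow_order_eq_1[of \<one>] by (simp add: Coset.order_def)
  then have "(\<one> \<oplus> \<one>) [^] l = \<zero>" using assms eq by simp
  then show ?thesis
    by (induction l) (auto simp: integral_iff)
qed

text \<open>The additive map \<open>y \<mapsto> y + y\<^sup>2\<close> has kernel \<open>{0, 1}\<close>, hence its image has index two and a single
  further element \<open>\<alpha>\<close> represents the other coset.\<close>

lemma (in field) artin_schreier_char_two:
  assumes fin: "finite (carrier R)" and char2: "\<one> \<oplus> \<one> = \<zero>"
  shows "\<exists>\<alpha>\<in>carrier R. \<forall>x\<in>carrier R. \<exists>c\<in>{\<zero>, \<alpha>}. \<exists>y\<in>carrier R. x = c \<oplus> (y \<oplus> y \<otimes> y)"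
proof -
  have dbl: "x \<oplus> x = \<zero>" if "x \<in> carrier R" for x
    using l_distr[of \<one> \<one> x] char2 that by simp
  then have minus: "\<ominus> x = x" if "x \<in> carrier R" for x
    using that dbl minus_equality by simp
  define g where "g y = y \<oplus> y \<otimes> y" for y
  define I where "I = g ` carrier R"
  have g_closed [simp]: "g y \<in> carrier R" if "y \<in> carrier R" for y
    using that by (simp add: g_def)
  have g_add: "g (x \<oplus> y) = g x \<oplus> g y" if "x \<in> carrier R" "y \<in> carrier R" for x y
  proof -
    have "(x \<oplus> y) \<otimes> (x \<oplus> y) = x \<otimes> x \<oplus> y \<otimes> y \<oplus> (x \<otimes> y \<oplus> x \<otimes> y)"
      using that by algebra
    then show ?thesis using that dbl[of "x \<otimes> y"] by (simp add: g_def a_ac)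
  qed
  interpret g: group_hom "add_monoid R" "add_monoid R" g
    by (rule group_hom.intro[OF a_group a_group])
       (auto simp: group_hom_axioms_def hom_def g_add)
  have ker: "kernel (add_monoid R) (add_monoid R) g = {\<zero>, \<one>}"
  proof -
    have "y = \<zero> \<or> y = \<one>" if "y \<in> carrier R" "g y = \<zero>" for y
    proof -
      have "y \<otimes> (\<one> \<oplus> y) = \<zero>" using that by (simp add: g_def r_distr)
      then have "y = \<zero> \<or> \<one> \<oplus> y = \<zero>" using that integral by auto
      then show ?thesis using that minus[of y] minus_equality[of \<one> y] by auto
    qed
    then show ?thesis
      using char2 by (auto simp: kernel_def g_def)
  qed
  have card: "card I * 2 = card (carrier R)"
    using g.card_image_times_kernel fin unfolding ker I_def Coset.order_def by simp
  have "card (carrier R) > 0" using fin by (simp add: card_gt_0_iff carrier_not_empty)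
  then have "card I < card (carrier R)" using card by linarith
  then have "I \<noteq> carrier R" by auto
  moreover have I_sub: "I \<subseteq> carrier R" by (auto simp: I_def)
  ultimately obtain \<alpha> where \<alpha>: "\<alpha> \<in> carrier R" "\<alpha> \<notin> I" by blast
  define I' where "I' = (\<lambda>z. \<alpha> \<oplus> z) ` I"
  have "I \<inter> I' = {}"
  proof (rule ccontr)
    assume "I \<inter> I' \<noteq> {}"
    then obtain x y where xy: "x \<in> carrier R" "y \<in> carrier R" "g x = \<alpha> \<oplus> g y"
      by (auto simp: I_def I'_def)
    then have "g (x \<oplus> y) = \<alpha>"
      using \<alpha> dbl[of "g y"] by (simp add: g_add a_assoc)
    then show False using \<alpha> xy by (auto simp: I_def)
  qed
  moreover have "card I' = card I"
    unfolding I'_def using I_sub \<alpha> by (intro card_image inj_onI) (metis add.l_cancel subsetD)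
  moreover have "finite I" using I_sub fin finite_subset by blast
  ultimately have "card (I \<union> I') = card (carrier R)"
    using card by (simp add: card_Un_disjoint I'_def)
  then have "I \<union> I' = carrier R"
    using I_sub \<alpha> fin by (intro card_subset_eq) (auto simp: I'_def)
  then have "\<exists>c\<in>{\<zero>, \<alpha>}. \<exists>y\<in>carrier R. x = c \<oplus> (y \<oplus> y \<otimes> y)" if "x \<in> carrier R" for x
    using that by (force simp: I_def I'_def g_def)
  with \<alpha> show ?thesis by blast
qed

section \<open>Evaluation of integer polynomials\<close>

abbreviation int_poly_ring :: "int poly ring"
  where "int_poly_ring \<equiv> ring_of_type_algebra"

text \<open>The value of an integer polynomial at an element of a ring, by the scheme of Horner.\<close>

definition int_poly_eval :: "('a, 'b) ring_scheme \<Rightarrow> 'a \<Rightarrow> int poly \<Rightarrow> 'a"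
  where "int_poly_eval R \<theta> p =
    fold_coeffs (\<lambda>c y. [c] \<cdot>\<^bsub>R\<^esub> \<one>\<^bsub>R\<^esub> \<oplus>\<^bsub>R\<^esub> \<theta> \<otimes>\<^bsub>R\<^esub> y) p \<zero>\<^bsub>R\<^esub>"

context cring
begin

context
  fixes \<theta> assumes \<theta> [simp]: "\<theta> \<in> carrier R"
begin

lemma int_poly_eval_0 [simp]: "int_poly_eval R \<theta> 0 = \<zero>"
  by (simp add: int_poly_eval_def)

lemma int_poly_eval_pCons:
  "int_poly_eval R \<theta> (pCons c p) = [c] \<cdot> \<one> \<oplus> \<theta> \<otimes> int_poly_eval R \<theta> p"
  by (cases "c = 0 \<and> p = 0") (auto simp: int_poly_eval_def add_pow_int_ge)

lemma int_poly_eval_closed [simp]: "int_poly_eval R \<theta> p \<in> carrier R"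
  by (induction p) (auto simp: int_poly_eval_pCons)

lemma int_poly_eval_add:
  "int_poly_eval R \<theta> (p + q) = int_poly_eval R \<theta> p \<oplus> int_poly_eval R \<theta> q"
proof (induction p q rule: poly_induct2)
  case (pCons a p b q)
  then show ?case
    by (simp add: int_poly_eval_pCons add.int_pow_mult r_distr a_ac)
qed simp

lemma int_poly_eval_smult:
  "int_poly_eval R \<theta> (Polynomial.smult c p) = [c] \<cdot> \<one> \<otimes> int_poly_eval R \<theta> p"
proof (induction p)
  case (pCons a p)
  have "[(c * a)] \<cdot> \<one> = [c] \<cdot> \<one> \<otimes> [a] \<cdot> \<one>"
    by (simp add: add_pow_ldistr_int add.int_pow_pow mult.commute)
  then show ?case
    using pCons by (simp add: int_poly_eval_pCons r_distr m_lcomm)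
qed simp

lemma int_poly_eval_mult:
  "int_poly_eval R \<theta> (p * q) = int_poly_eval R \<theta> p \<otimes> int_poly_eval R \<theta> q"
  by (induction p)
     (simp_all add: int_poly_eval_add int_poly_eval_smult int_poly_eval_pCons l_distr m_assoc add_pow_int_ge)

lemma int_poly_eval_1: "int_poly_eval R \<theta> 1 = \<one>"
  by (simp add: one_pCons int_poly_eval_pCons)

lemma int_poly_eval_hom: "int_poly_eval R \<theta> \<in> ring_hom int_poly_ring R"
  by (rule ring_hom_memI)
     (auto simp: ring_of_type_algebra_def int_poly_eval_add int_poly_eval_mult int_poly_eval_1)

lemma int_poly_eval_uminus: "int_poly_eval R \<theta> (- p) = \<ominus> int_poly_eval R \<theta> p"
  using int_poly_eval_add[of "-p" p] by (simp add: minus_equality)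

lemma int_poly_eval_diff: "int_poly_eval R \<theta> (p - q) = int_poly_eval R \<theta> p \<ominus> int_poly_eval R \<theta> q"
  using int_poly_eval_add[of p "-q"] by (simp add: int_poly_eval_uminus a_minus_def)

lemma int_poly_eval_X_power: "int_poly_eval R \<theta> (Polynomial.monom 1 i) = \<theta> [^] i"
proof (induction i)
  case 0
  show ?case by (simp add: int_poly_eval_1 flip: one_pCons)
next
  case (Suc i)
  then show ?case by (simp add: monom_Suc int_poly_eval_pCons m_comm add_pow_int_ge)
qed

end

end

text \<open>
  A presentation of a field as the quotient of the integer polynomials by \<open>(2, f)\<close>, with \<open>f\<close> monic
  of positive degree. The field is then finite of characteristic two, and \<open>f\<close> is irreducible
  modulo two.
\<close>

locale int_poly_residue = F: field F for F (structure) +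
  fixes f :: "int poly" and ev :: "int poly \<Rightarrow> 'a"
  assumes ev_hom: "ev \<in> ring_hom int_poly_ring F"
    and ev_surj: "range ev = carrier F"
    and ev_kernel: "ev p = \<zero>\<^bsub>F\<^esub> \<longleftrightarrow> p \<in> two_pow_ideal f 1"
    and monic: "lead_coeff f = 1"
    and degree_pos: "Polynomial.degree f > 0"

text \<open>Take \<open>\<theta>\<close> a generator of the multiplicative group and \<open>f\<close> monic of least degree with \<open>f(\<theta>) = 0\<close>.\<close>

lemma (in field) ex_int_poly_residue:
  assumes ord: "order R = 2 ^ l"
  shows "\<exists>f ev. int_poly_residue R f ev"
proof -
  have fin: "finite (carrier R)"
    using ord by (metis card_ge_0_finite Coset.order_def zero_less_numeral zero_less_power)
  obtain \<theta> where \<theta>: "\<theta> \<in> carrier (Multiplicative_Group.mult_of R)"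
      "carrier (Multiplicative_Group.mult_of R) = {\<theta> [^] i | i :: nat. i \<in> UNIV}"
    using finite_field_mult_group_has_gen[OF fin] by auto
  then have \<theta>_R [simp]: "\<theta> \<in> carrier R" by simp
  let ?ev = "int_poly_eval R \<theta>"
  note char2 = char_two_of_order[OF ord]
  have ev2: "?ev (2 * p) = \<zero>" for p
  proof -
    have "?ev (2 * p) = (\<one> \<oplus> \<one>) \<otimes> ?ev p"
      by (simp only: mult_2 int_poly_eval_add[OF \<theta>_R]) (simp add: l_distr)
    then show ?thesis using char2 by simp
  qed
  define Q where "Q g \<longleftrightarrow> lead_coeff g = 1 \<and> ?ev g = \<zero>" for g
  have "\<exists>g. Q g"
  proof -
    define k where "k = order (Multiplicative_Group.mult_of R)"
    have grp: "group (Multiplicative_Group.mult_of R)" by (rule field_mult_group)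
    have "k > 0"
      using \<theta>(1) finite_mult_of[OF fin] unfolding k_def Coset.order_def
      by (subst card_gt_0_iff) blast
    moreover have "\<theta> [^] k = \<one>"
      using group.pow_order_eq_1[OF grp \<theta>(1)] by (simp add: Multiplicative_Group.nat_pow_mult_of k_def)
    ultimately have k: "k > 0" "\<theta> [^] k = \<one>" by auto
    let ?g = "Polynomial.monom 1 k - 1 :: int poly"
    have "Polynomial.degree ?g = k"
      using k by (subst degree_add_eq_left[of "-1", simplified])
        (auto simp: Polynomial.degree_monom_eq)
    then have "lead_coeff ?g = 1" using k by (simp add: Polynomial.coeff_monom)
    moreover have "?ev ?g = \<zero>"
      using k by (simp add: int_poly_eval_diff int_poly_eval_X_power int_poly_eval_1)
    ultimately show ?thesis unfolding Q_def by blast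
  qed
  then obtain f where f: "Q f" "\<And>g. Q g \<Longrightarrow> Polynomial.degree f \<le> Polynomial.degree g"
    using ex_has_least_nat[of Q _ Polynomial.degree] by blast
  have f_pos: "Polynomial.degree f > 0"
  proof (rule ccontr)
    assume "\<not> Polynomial.degree f > 0"
    then obtain c where "f = [:c:]" by (auto elim: degree_eq_zeroE)
    then have "f = 1" using f(1) by (simp add: Q_def one_pCons)
    then show False using f(1) by (simp add: Q_def int_poly_eval_1)
  qed
  \<comment> \<open>Reducing the coefficients of \<open>r\<close> modulo two gives a polynomial that is zero or monic; the second
    contradicts the minimality of \<open>f\<close>.\<close>
  have even: "\<exists>s. r = 2 * s" if r: "?ev r = \<zero>" "Polynomial.degree r < Polynomial.degree f" for r
  proof -
    define c where "c i = Polynomial.coeff r i mod 2" for i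
    define s where "s = poly_of_coeffs (Polynomial.degree f) (\<lambda>i. Polynomial.coeff r i div 2)"
    define r' where "r' = poly_of_coeffs (Polynomial.degree f) c"
    have eq: "r = 2 * s + r'"
    proof (rule poly_eqI)
      fix i
      show "Polynomial.coeff r i = Polynomial.coeff (2 * s + r') i"
        using r(2) coeff_two_power_mult[of 1 s i]
        by (auto simp: r'_def s_def c_def coeff_poly_of_coeffs coeff_eq_0)
    qed
    have "?ev r' = \<zero>" using r(1) by (simp add: eq int_poly_eval_add ev2)
    have "r' = 0"
    proof (rule ccontr)
      assume "r' \<noteq> 0"
      then have "lead_coeff r' \<noteq> 0" by simp
      then have "lead_coeff r' = 1" and "Polynomial.degree r' < Polynomial.degree f"
        by (auto simp: r'_def coeff_poly_of_coeffs c_def split: if_splits)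
      then show False using \<open>?ev r' = \<zero>\<close> f(2)[of r'] by (simp add: Q_def)
    qed
    then show ?thesis using eq by auto
  qed
  have ker: "?ev p = \<zero> \<longleftrightarrow> p \<in> two_pow_ideal f 1" for p
  proof
    assume "p \<in> two_pow_ideal f 1"
    then obtain s t where "p = 2 * s + f * t" by (auto elim: two_pow_idealE)
    then show "?ev p = \<zero>"
      using f(1) by (simp add: Q_def int_poly_eval_add int_poly_eval_mult ev2)
  next
    assume 0: "?ev p = \<zero>"
    obtain q r where qr: "p = f * q + r" "Polynomial.degree r < Polynomial.degree f"
      using monic_division[of f p] f(1) f_pos by (auto simp: Q_def)
    then have "?ev r = \<zero>"
      using 0 f(1) by (simp add: Q_def int_poly_eval_add int_poly_eval_mult)
    then obtain s where "r = 2 * s" using even qr by blast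
    then show "p \<in> two_pow_ideal f 1"
      using qr by (intro two_pow_idealI[where s = s and t = q]) simp
  qed
  have surj: "range ?ev = carrier R"
  proof
    show "carrier R \<subseteq> range ?ev"
    proof
      fix x assume x: "x \<in> carrier R"
      show "x \<in> range ?ev"
      proof (cases "x = \<zero>")
        case True
        then show ?thesis by (intro image_eqI[of _ _ 0]) auto
      next
        case False
        then obtain i :: nat where "x = \<theta> [^] i"
          using x \<theta>(2) by (auto simp: Multiplicative_Group.nat_pow_mult_of)
        then show ?thesis
          by (intro image_eqI[of _ _ "Polynomial.monom 1 i"]) (auto simp: int_poly_eval_X_power)
      qed
    qed
  qed auto
  have "int_poly_residue R f ?ev"
    by unfold_locales
       (use f(1) in \<open>simp_all add: ker surj f_pos int_poly_eval_hom Q_def\<close>)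
  then show ?thesis by blast
qed

section \<open>Local and artinian rings\<close>

text \<open>If every element outside the kernel of a homomorphism to a field is a unit, that kernel contains
  every proper ideal.\<close>

lemma local_cringI_residue_hom:
  assumes "cring A" "field F" and \<sigma>: "\<sigma> \<in> ring_hom A F"
    and units: "\<And>x. x \<in> carrier A \<Longrightarrow> \<sigma> x \<noteq> \<zero>\<^bsub>F\<^esub> \<Longrightarrow> x \<in> Units A"
  shows "local_cring A"
proof -
  interpret A: cring A by fact
  interpret F: field F by fact
  interpret \<sigma>: ring_hom_ring A F \<sigma>
    by (rule ring_hom_ringI2) (use \<sigma> A.ring_axioms F.ring_axioms in auto)
  define N where "N = a_kernel A F \<sigma>"
  have N: "ideal N A" unfolding N_def by (rule \<sigma>.kernel_is_ideal)
  have N_iff: "x \<in> N \<longleftrightarrow> x \<in> carrier A \<and> \<sigma> x = \<zero>\<^bsub>F\<^esub>" for x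
    unfolding N_def a_kernel_def' by blast
  have one: "\<one>\<^bsub>A\<^esub> \<notin> N" by (simp add: N_iff)
  have sub: "J \<subseteq> N" if J: "ideal J A" "J \<noteq> carrier A" for J
  proof
    fix x assume x: "x \<in> J"
    interpret J: ideal J A by fact
    show "x \<in> N"
    proof (rule ccontr)
      assume "x \<notin> N"
      then have u: "x \<in> Units A" using x units by (auto simp: N_iff)
      then have "inv\<^bsub>A\<^esub> x \<otimes>\<^bsub>A\<^esub> x \<in> J" using x by (intro J.I_l_closed) auto
      then have "\<one>\<^bsub>A\<^esub> \<in> J" using u by simp
      then show False using J.one_imp_carrier J(2) by blast
    qed
  qed
  have max: "maximalideal N A"
  proof (rule maximalideal.intro[OF N], unfold_locales)
    show "carrier A \<noteq> N" using one by auto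
    show "J = N \<or> J = carrier A" if "ideal J A" "N \<subseteq> J" "J \<subseteq> carrier A" for J
      using sub[OF that(1)] that(2) by blast
  qed
  have "M = N" if M: "maximalideal M A" for M
  proof -
    interpret M: maximalideal M A by fact
    have "M \<subseteq> N" using sub[OF M.is_ideal] M.I_notcarr by blast
    moreover have "N \<subseteq> carrier A" by (auto simp: N_iff)
    ultimately have "N = M \<or> N = carrier A" using M.I_maximal[OF N] by blast
    then show ?thesis using one by auto
  qed
  then show ?thesis
    by (intro local_cring.intro[OF \<open>cring A\<close>] local_cring_axioms.intro ex1I[of _ N] max)
qed

lemma artinian_cringI_finite:
  assumes "cring A" "finite (carrier A)"
  shows "artinian_cring A"
proof (rule artinian_cring.intro[OF assms(1)], unfold_locales)
  fix I :: "nat \<Rightarrow> 'a set"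
  assume I: "\<And>n. ideal (I n) A" "\<And>n. I (Suc n) \<subseteq> I n"
  obtain n where n: "\<And>m. card (I n) \<le> card (I m)"
    using ex_has_least_nat[of "\<lambda>_. True" 0 "\<lambda>n. card (I n)"] by auto
  have "I m = I n" if "m \<ge> n" for m
  proof (rule card_subset_eq[rotated])
    show sub: "I m \<subseteq> I n" using I(2) that by (rule lift_Suc_antimono_le)
    have "I n \<subseteq> carrier A" using I(1) by (simp add: additive_subgroup.a_subset ideal.axioms)
    then show "finite (I n)" using assms(2) finite_subset by blast
    then show "card (I m) = card (I n)" using sub n by (simp add: card_mono le_antisym)
  qed
  then show "\<exists>n. \<forall>m\<ge>n. I m = I n" by blast
qed

section \<open>Idealization of a dual module\<close>

text \<open>Homomorphisms from the additive group of \<open>R\<close> to \<open>P\<close>, under the pointwise operation of \<open>P\<close>, which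
  is written multiplicatively. The functions are taken extensional, so that equality is equality on
  the carrier.\<close>

definition hom_group :: "('a, 'b) ring_scheme \<Rightarrow> ('p, 'm) monoid_scheme \<Rightarrow> ('a \<Rightarrow> 'p) monoid"
  where "hom_group R P =
    \<lparr>carrier = {\<phi> \<in> extensional (carrier R). \<phi> \<in> hom (add_monoid R) P},
     monoid.mult = (\<lambda>\<phi> \<psi>. \<lambda>x\<in>carrier R. \<phi> x \<otimes>\<^bsub>P\<^esub> \<psi> x),
     one = (\<lambda>x\<in>carrier R. \<one>\<^bsub>P\<^esub>)\<rparr>"

text \<open>The action of \<open>R\<close> on homomorphisms, by multiplication in the argument.\<close>

definition hom_scale :: "('a, 'b) ring_scheme \<Rightarrow> 'a \<Rightarrow> ('a \<Rightarrow> 'p) \<Rightarrow> 'a \<Rightarrow> 'p"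
  where "hom_scale R r \<phi> = (\<lambda>x\<in>carrier R. \<phi> (r \<otimes>\<^bsub>R\<^esub> x))"

text \<open>The idealization (trivial extension) of \<open>R\<close> by the module of homomorphisms to \<open>P\<close>: the product
  is \<open>(r, \<phi>)(s, \<psi>) = (r s, s \<phi> + r \<psi>)\<close>. The module is a square-zero ideal.\<close>

definition hom_idealization ::
    "('a, 'b) ring_scheme \<Rightarrow> ('p, 'm) monoid_scheme \<Rightarrow> ('a \<times> ('a \<Rightarrow> 'p)) ring"
  where "hom_idealization R P =
    \<lparr>carrier = carrier R \<times> carrier (hom_group R P),
     monoid.mult = (\<lambda>(r, \<phi>) (s, \<psi>).
       (r \<otimes>\<^bsub>R\<^esub> s, hom_scale R s \<phi> \<otimes>\<^bsub>hom_group R P\<^esub> hom_scale R r \<psi>)),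
     one = (\<one>\<^bsub>R\<^esub>, \<one>\<^bsub>hom_group R P\<^esub>),
     ring.zero = (\<zero>\<^bsub>R\<^esub>, \<one>\<^bsub>hom_group R P\<^esub>),
     add = (\<lambda>(r, \<phi>) (s, \<psi>). (r \<oplus>\<^bsub>R\<^esub> s, \<phi> \<otimes>\<^bsub>hom_group R P\<^esub> \<psi>))\<rparr>"

locale ring_and_group = R: cring R + P: comm_group P
  for R :: "('a, 'b) ring_scheme" (structure) and P :: "('p, 'm) monoid_scheme" (structure)
begin

abbreviation "H \<equiv> hom_group R P"
abbreviation "A \<equiv> hom_idealization R P"

lemma hom_groupD:
  assumes "\<phi> \<in> carrier H"
  shows "x \<in> carrier R \<Longrightarrow> \<phi> x \<in> carrier P"
    and "x \<in> carrier R \<Longrightarrow> y \<in> carrier R \<Longrightarrow> \<phi> (x \<oplus>\<^bsub>R\<^esub> y) = \<phi> x \<otimes>\<^bsub>P\<^esub> \<phi> y"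
    and "\<phi> \<zero>\<^bsub>R\<^esub> = \<one>\<^bsub>P\<^esub>"
    and "\<phi> \<in> extensional (carrier R)"
proof -
  have \<phi>: "\<phi> \<in> hom (add_monoid R) P" using assms by (simp add: hom_group_def)
  show "x \<in> carrier R \<Longrightarrow> \<phi> x \<in> carrier P"
    and "x \<in> carrier R \<Longrightarrow> y \<in> carrier R \<Longrightarrow> \<phi> (x \<oplus>\<^bsub>R\<^esub> y) = \<phi> x \<otimes>\<^bsub>P\<^esub> \<phi> y"
    using \<phi> by (auto simp: hom_def)
  show "\<phi> \<zero>\<^bsub>R\<^esub> = \<one>\<^bsub>P\<^esub>"
    using hom_one[OF \<phi> R.a_group P.is_group] by simp
  show "\<phi> \<in> extensional (carrier R)" using assms by (simp add: hom_group_def)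
qed

lemma hom_groupI:
  assumes "\<phi> \<in> extensional (carrier R)" "\<And>x. x \<in> carrier R \<Longrightarrow> \<phi> x \<in> carrier P"
    "\<And>x y. x \<in> carrier R \<Longrightarrow> y \<in> carrier R \<Longrightarrow> \<phi> (x \<oplus>\<^bsub>R\<^esub> y) = \<phi> x \<otimes>\<^bsub>P\<^esub> \<phi> y"
  shows "\<phi> \<in> carrier H"
  using assms by (auto simp: hom_group_def hom_def)

lemma hom_group_ext:
  assumes "\<phi> \<in> carrier H" "\<psi> \<in> carrier H" "\<And>x. x \<in> carrier R \<Longrightarrow> \<phi> x = \<psi> x"
  shows "\<phi> = \<psi>"
  using assms hom_groupD(4) by (metis extensionalityI)

lemma hom_group_mult: "x \<in> carrier R \<Longrightarrow> (\<phi> \<otimes>\<^bsub>H\<^esub> \<psi>) x = \<phi> x \<otimes>\<^bsub>P\<^esub> \<psi> x"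
  and hom_group_one: "x \<in> carrier R \<Longrightarrow> \<one>\<^bsub>H\<^esub> x = \<one>\<^bsub>P\<^esub>"
  and hom_scale_apply: "x \<in> carrier R \<Longrightarrow> hom_scale R r \<phi> x = \<phi> (r \<otimes>\<^bsub>R\<^esub> x)"
  by (simp_all add: hom_group_def hom_scale_def)

lemma hom_group_mult_closed:
  assumes "\<phi> \<in> carrier H" "\<psi> \<in> carrier H" shows "\<phi> \<otimes>\<^bsub>H\<^esub> \<psi> \<in> carrier H"
proof (rule hom_groupI)
  show "\<phi> \<otimes>\<^bsub>H\<^esub> \<psi> \<in> extensional (carrier R)" by (simp add: hom_group_def)
qed (use assms in \<open>simp_all add: hom_group_mult hom_groupD P.m_ac\<close>)

lemma hom_group_one_closed: "\<one>\<^bsub>H\<^esub> \<in> carrier H"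
proof (rule hom_groupI)
  show "\<one>\<^bsub>H\<^esub> \<in> extensional (carrier R)" by (simp add: hom_group_def)
qed (simp_all add: hom_group_one)

lemma hom_scale_closed:
  assumes "\<phi> \<in> carrier H" "r \<in> carrier R" shows "hom_scale R r \<phi> \<in> carrier H"
  using assms
  by (intro hom_groupI) (simp_all add: hom_groupD hom_scale_apply R.r_distr, simp add: hom_scale_def)

lemma hom_group_inverse:
  assumes "\<phi> \<in> carrier H"
  defines "\<psi> \<equiv> \<lambda>x\<in>carrier R. inv\<^bsub>P\<^esub> \<phi> x"
  shows "\<psi> \<in> carrier H" "\<psi> \<otimes>\<^bsub>H\<^esub> \<phi> = \<one>\<^bsub>H\<^esub>"
proof -
  show \<psi>: "\<psi> \<in> carrier H"
    by (rule hom_groupI) (use assms in \<open>simp_all add: hom_groupD P.inv_mult\<close>)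
  show "\<psi> \<otimes>\<^bsub>H\<^esub> \<phi> = \<one>\<^bsub>H\<^esub>"
    by (rule hom_group_ext)
       (use assms \<psi> in \<open>simp_all add: hom_groupD hom_group_mult hom_group_one
          hom_group_mult_closed hom_group_one_closed\<close>)
qed

lemma comm_group_hom_group: "comm_group H"
proof (rule comm_groupI)
  fix \<phi> assume "\<phi> \<in> carrier H"
  then show "\<exists>\<psi>\<in>carrier H. \<psi> \<otimes>\<^bsub>H\<^esub> \<phi> = \<one>\<^bsub>H\<^esub>" using hom_group_inverse by blast
next
  fix \<phi> \<psi> \<chi> assume H: "\<phi> \<in> carrier H" "\<psi> \<in> carrier H" "\<chi> \<in> carrier H"
  show "\<phi> \<otimes>\<^bsub>H\<^esub> \<psi> \<otimes>\<^bsub>H\<^esub> \<chi> = \<phi> \<otimes>\<^bsub>H\<^esub> (\<psi> \<otimes>\<^bsub>H\<^esub> \<chi>)"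
    by (rule hom_group_ext)
       (use H in \<open>simp_all add: hom_group_mult_closed hom_group_mult hom_groupD P.m_assoc\<close>)
next
  fix \<phi> \<psi> assume H: "\<phi> \<in> carrier H" "\<psi> \<in> carrier H"
  show "\<phi> \<otimes>\<^bsub>H\<^esub> \<psi> = \<psi> \<otimes>\<^bsub>H\<^esub> \<phi>"
    by (rule hom_group_ext)
       (use H in \<open>simp_all add: hom_group_mult_closed hom_group_mult hom_groupD P.m_comm\<close>)
next
  fix \<phi> assume H: "\<phi> \<in> carrier H"
  show "\<one>\<^bsub>H\<^esub> \<otimes>\<^bsub>H\<^esub> \<phi> = \<phi>"
    by (rule hom_group_ext)
       (use H in \<open>simp_all add: hom_group_mult_closed hom_group_one_closed hom_group_mult
          hom_group_one hom_groupD\<close>)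
qed (simp_all add: hom_group_mult_closed hom_group_one_closed)

lemma carrier_hom_idealization: "carrier A = carrier R \<times> carrier H"
  and mult_hom_idealization: "(r, \<phi>) \<otimes>\<^bsub>A\<^esub> (s, \<psi>) = (r \<otimes>\<^bsub>R\<^esub> s, hom_scale R s \<phi> \<otimes>\<^bsub>H\<^esub> hom_scale R r \<psi>)"
  and one_hom_idealization: "\<one>\<^bsub>A\<^esub> = (\<one>\<^bsub>R\<^esub>, \<one>\<^bsub>H\<^esub>)"
  and zero_hom_idealization: "\<zero>\<^bsub>A\<^esub> = (\<zero>\<^bsub>R\<^esub>, \<one>\<^bsub>H\<^esub>)"
  and add_hom_idealization: "(r, \<phi>) \<oplus>\<^bsub>A\<^esub> (s, \<psi>) = (r \<oplus>\<^bsub>R\<^esub> s, \<phi> \<otimes>\<^bsub>H\<^esub> \<psi>)"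
  by (simp_all add: hom_idealization_def)

lemmas hom_idealization_simps = carrier_hom_idealization mult_hom_idealization
  one_hom_idealization zero_hom_idealization add_hom_idealization

lemmas hom_group_simps = hom_group_mult hom_group_one hom_scale_apply hom_groupD

lemmas hom_group_closed = hom_group_mult_closed hom_group_one_closed hom_scale_closed

lemma cring_hom_idealization: "cring A"
proof (rule cringI)
  interpret H: comm_group H by (rule comm_group_hom_group)
  show "abelian_group A"
  proof (rule abelian_groupI)
    fix x assume "x \<in> carrier A"
    then obtain r \<phi> where x: "x = (r, \<phi>)" "r \<in> carrier R" "\<phi> \<in> carrier H"
      by (auto simp: hom_idealization_simps)
    then show "\<exists>y\<in>carrier A. y \<oplus>\<^bsub>A\<^esub> x = \<zero>\<^bsub>A\<^esub>"
      by (intro bexI[of _ "(\<ominus>\<^bsub>R\<^esub> r, inv\<^bsub>H\<^esub> \<phi>)"])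
         (auto simp: hom_idealization_simps R.l_neg H.l_inv)
  qed (auto simp: hom_idealization_simps R.a_ac H.m_ac)
  show "Group.comm_monoid A"
  proof (rule comm_monoidI)
    fix x y z assume "x \<in> carrier A" "y \<in> carrier A" "z \<in> carrier A"
    then show "(x \<otimes>\<^bsub>A\<^esub> y) \<otimes>\<^bsub>A\<^esub> z = x \<otimes>\<^bsub>A\<^esub> (y \<otimes>\<^bsub>A\<^esub> z)"
      by (auto simp: hom_idealization_simps hom_group_simps hom_group_closed R.m_ac P.m_ac
           intro!: hom_group_ext)
  next
    fix x y assume "x \<in> carrier A" "y \<in> carrier A"
    then show "x \<otimes>\<^bsub>A\<^esub> y = y \<otimes>\<^bsub>A\<^esub> x"
      by (auto simp: hom_idealization_simps hom_scale_closed R.m_comm H.m_comm)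
  next
    fix x assume "x \<in> carrier A"
    then show "\<one>\<^bsub>A\<^esub> \<otimes>\<^bsub>A\<^esub> x = x"
      by (auto simp: hom_idealization_simps hom_group_simps hom_group_closed
           intro!: hom_group_ext)
  qed (auto simp: hom_idealization_simps hom_group_closed)
  fix x y z assume "x \<in> carrier A" "y \<in> carrier A" "z \<in> carrier A"
  then show "(x \<oplus>\<^bsub>A\<^esub> y) \<otimes>\<^bsub>A\<^esub> z = x \<otimes>\<^bsub>A\<^esub> z \<oplus>\<^bsub>A\<^esub> y \<otimes>\<^bsub>A\<^esub> z"
    by (auto simp: hom_idealization_simps hom_group_simps hom_group_closed R.l_distr P.m_ac
         intro!: hom_group_ext)
qed

lemma hom_scale_inverse:
  assumes "r \<in> carrier R" "s \<in> carrier R" "r \<otimes>\<^bsub>R\<^esub> s = \<one>\<^bsub>R\<^esub>" "\<phi> \<in> carrier H"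
  shows "hom_scale R r (hom_scale R s \<phi>) = \<phi>"
proof (rule hom_group_ext)
  fix x assume x: "x \<in> carrier R"
  then have "s \<otimes>\<^bsub>R\<^esub> (r \<otimes>\<^bsub>R\<^esub> x) = r \<otimes>\<^bsub>R\<^esub> s \<otimes>\<^bsub>R\<^esub> x"
    using assms(1,2) by (simp add: R.m_ac)
  then show "hom_scale R r (hom_scale R s \<phi>) x = \<phi> x"
    using assms x by (simp add: hom_group_simps)
qed (use assms in \<open>simp_all add: hom_group_closed\<close>)

lemma Units_hom_idealization: "Units A = Units R \<times> carrier H"
proof (intro equalityI subsetI)
  fix x assume "x \<in> Units A"
  then show "x \<in> Units R \<times> carrier H"
    by (fastforce simp: Units_def hom_idealization_simps)
next
  interpret A: cring A by (rule cring_hom_idealization)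
  interpret H: comm_group H by (rule comm_group_hom_group)
  fix x assume "x \<in> Units R \<times> carrier H"
  then obtain r \<phi> where x: "x = (r, \<phi>)" "r \<in> Units R" "\<phi> \<in> carrier H" by auto
  define s where "s = inv\<^bsub>R\<^esub> r"
  have rs: "r \<in> carrier R" "s \<in> carrier R" "r \<otimes>\<^bsub>R\<^esub> s = \<one>\<^bsub>R\<^esub>" "s \<otimes>\<^bsub>R\<^esub> r = \<one>\<^bsub>R\<^esub>"
    using x by (auto simp: s_def R.Units_r_inv R.Units_l_inv)
  define \<psi> where "\<psi> = hom_scale R s (inv\<^bsub>H\<^esub> hom_scale R s \<phi>)"
  have "hom_scale R r \<psi> = inv\<^bsub>H\<^esub> hom_scale R s \<phi>"
    using rs x unfolding \<psi>_def by (intro hom_scale_inverse) (auto intro: hom_scale_closed)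
  then have "x \<otimes>\<^bsub>A\<^esub> (s, \<psi>) = \<one>\<^bsub>A\<^esub>"
    using x rs by (simp add: hom_idealization_simps hom_scale_closed H.r_inv)
  moreover have "(s, \<psi>) \<in> carrier A" "x \<in> carrier A"
    using x rs by (auto simp: hom_idealization_simps \<psi>_def intro!: hom_scale_closed)
  ultimately show "x \<in> Units A"
    unfolding Units_def using A.m_comm[of x "(s, \<psi>)"] by auto
qed

text \<open>The isomorphism sends \<open>(u, \<phi>)\<close> to \<open>(u, u \<phi>) = (u, 0)(1, \<phi>)\<close>.\<close>

lemma units_hom_idealization_iso: "units_of R \<times>\<times> H \<cong> units_of A"
proof (rule is_isoI)
  interpret H: comm_group H by (rule comm_group_hom_group)
  let ?\<Theta> = "\<lambda>(u, \<phi>). (u, hom_scale R u \<phi>)"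
  have hom: "?\<Theta> \<in> hom (units_of R \<times>\<times> H) (units_of A)"
  proof (rule homI)
    fix x y assume "x \<in> carrier (units_of R \<times>\<times> H)" "y \<in> carrier (units_of R \<times>\<times> H)"
    moreover obtain u \<phi> v \<psi> where xy: "x = (u, \<phi>)" "y = (v, \<psi>)" by fastforce
    ultimately have cl: "u \<in> carrier R" "v \<in> carrier R" "\<phi> \<in> carrier H" "\<psi> \<in> carrier H"
      by (auto simp: units_of_def)
    have "hom_scale R (u \<otimes>\<^bsub>R\<^esub> v) (\<phi> \<otimes>\<^bsub>H\<^esub> \<psi>) =
        hom_scale R v (hom_scale R u \<phi>) \<otimes>\<^bsub>H\<^esub> hom_scale R u (hom_scale R v \<psi>)"
      using cl by (intro hom_group_ext) (simp_all add: hom_group_closed hom_group_simps R.m_ac)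
    then show "?\<Theta> (x \<otimes>\<^bsub>units_of R \<times>\<times> H\<^esub> y) = ?\<Theta> x \<otimes>\<^bsub>units_of A\<^esub> ?\<Theta> y"
      by (simp add: xy units_of_def hom_idealization_simps)
  qed (auto simp: units_of_def Units_hom_idealization hom_scale_closed)
  moreover have "bij_betw ?\<Theta> (Units R \<times> carrier H) (Units A)"
    unfolding Units_hom_idealization
    by (rule bij_betwI[where g = "\<lambda>(u, \<phi>). (u, hom_scale R (inv\<^bsub>R\<^esub> u) \<phi>)"])
       (auto intro!: hom_scale_closed hom_scale_inverse)
  ultimately show "?\<Theta> \<in> iso (units_of R \<times>\<times> H) (units_of A)"
    by (simp add: iso_def units_of_carrier)
qed

end

section \<open>Homomorphisms out of products of cyclic groups\<close>

lemma (in group) int_pow_mod: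
  assumes "g \<in> carrier G" "g [^] (m :: nat) = \<one>"
  shows "g [^] (k mod int m) = g [^] (k :: int)"
proof -
  have "g [^] k = g [^] (int m * (k div int m) + k mod int m)" by simp
  also have "\<dots> = g [^] (int m * (k div int m)) \<otimes> g [^] (k mod int m)"
    using assms by (simp only: int_pow_mult)
  also have "g [^] (int m * (k div int m)) = (g [^] int m) [^] (k div int m)"
    using assms by (simp only: int_pow_pow)
  also have "\<dots> = \<one>" using assms by (simp add: int_pow_int)
  finally show ?thesis using assms by simp
qed

lemma (in group) integer_mod_group_hom:
  assumes "g \<in> carrier G" "g [^] (m :: nat) = \<one>"
  shows "(\<lambda>k. g [^] (k :: int)) \<in> hom (integer_mod_group m) G"
  using assms by (intro homI) (simp_all add: int_pow_mod int_pow_mult)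

lemma (in group) generator_in_image:
  assumes "g \<in> carrier G" "g [^] (m :: nat) = \<one>" "m > 0"
  shows "g \<in> (\<lambda>k. g [^] (k :: int)) ` carrier (integer_mod_group m)"
proof (rule image_eqI)
  show "g = g [^] (1 mod int m)" using int_pow_mod[OF assms(1,2), of 1] assms by simp
  show "1 mod int m \<in> carrier (integer_mod_group m)"
    using assms by (simp add: carrier_integer_mod_group)
qed

lemma (in comm_group) DirProd_hom:
  assumes "h \<in> hom K G" "h' \<in> hom L G"
  shows "(\<lambda>(x, y). h x \<otimes> h' y) \<in> hom (K \<times>\<times> L) G"
  using assms by (intro homI) (auto simp: hom_def Pi_iff m_ac)

lemma (in group) DirProd_hom_image:
  assumes "h \<in> hom K G" "h' \<in> hom L G" "group K" "group L"
  shows "h ` carrier K \<subseteq> (\<lambda>(x, y). h x \<otimes> h' y) ` carrier (K \<times>\<times> L)"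
    and "h' ` carrier L \<subseteq> (\<lambda>(x, y). h x \<otimes> h' y) ` carrier (K \<times>\<times> L)"
proof -
  have one: "h \<one>\<^bsub>K\<^esub> = \<one>" "h' \<one>\<^bsub>L\<^esub> = \<one>"
    using assms hom_one is_group by blast+
  have cl: "\<one>\<^bsub>K\<^esub> \<in> carrier K" "\<one>\<^bsub>L\<^esub> \<in> carrier L"
    using assms by (simp_all add: group.is_monoid)
  show "h ` carrier K \<subseteq> (\<lambda>(x, y). h x \<otimes> h' y) ` carrier (K \<times>\<times> L)"
  proof
    fix z assume "z \<in> h ` carrier K"
    then obtain x where "x \<in> carrier K" "z = h x" by auto
    then show "z \<in> (\<lambda>(x, y). h x \<otimes> h' y) ` carrier (K \<times>\<times> L)"
      using one cl hom_in_carrier[OF assms(1)] by (intro image_eqI[of _ _ "(x, \<one>\<^bsub>L\<^esub>)"]) auto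
  qed
  show "h' ` carrier L \<subseteq> (\<lambda>(x, y). h x \<otimes> h' y) ` carrier (K \<times>\<times> L)"
  proof
    fix z assume "z \<in> h' ` carrier L"
    then obtain x where "x \<in> carrier L" "z = h' x" by auto
    then show "z \<in> (\<lambda>(x, y). h x \<otimes> h' y) ` carrier (K \<times>\<times> L)"
      using one cl hom_in_carrier[OF assms(2)] by (intro image_eqI[of _ _ "(\<one>\<^bsub>K\<^esub>, x)"]) auto
  qed
qed

lemma (in comm_group) product_group_hom:
  assumes "finite I" "\<And>i. i \<in> I \<Longrightarrow> h i \<in> hom (K i) G"
  shows "(\<lambda>x. \<Otimes>i\<in>I. h i (x i)) \<in> hom (product_group I K) G"
proof (rule homI)
  show "(\<Otimes>i\<in>I. h i (x i)) \<in> carrier G" if "x \<in> carrier (product_group I K)" for x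
    using that assms(2) by (intro finprod_closed) (auto simp: hom_def Pi_iff PiE_iff)
  fix x y assume xy: "x \<in> carrier (product_group I K)" "y \<in> carrier (product_group I K)"
  have "(\<Otimes>i\<in>I. h i ((x \<otimes>\<^bsub>product_group I K\<^esub> y) i)) = (\<Otimes>i\<in>I. h i (x i) \<otimes> h i (y i))"
    using xy assms(2) by (intro finprod_cong') (auto simp: hom_def Pi_iff PiE_iff)
  also have "\<dots> = (\<Otimes>i\<in>I. h i (x i)) \<otimes> (\<Otimes>i\<in>I. h i (y i))"
    using xy assms(2) by (intro finprod_multf) (auto simp: hom_def Pi_iff PiE_iff)
  finally show "(\<Otimes>i\<in>I. h i ((x \<otimes>\<^bsub>product_group I K\<^esub> y) i)) =
      (\<Otimes>i\<in>I. h i (x i)) \<otimes> (\<Otimes>i\<in>I. h i (y i))" .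
qed

lemma (in comm_group) product_group_hom_image:
  assumes "finite I" "\<And>i. i \<in> I \<Longrightarrow> h i \<in> hom (K i) G" "\<And>i. i \<in> I \<Longrightarrow> group (K i)" "j \<in> I"
  shows "h j ` carrier (K j) \<subseteq> (\<lambda>x. \<Otimes>i\<in>I. h i (x i)) ` carrier (product_group I K)"
proof
  fix z assume "z \<in> h j ` carrier (K j)"
  then obtain x where x: "x \<in> carrier (K j)" "z = h j x" by auto
  have one: "h i \<one>\<^bsub>K i\<^esub> = \<one>" "\<one>\<^bsub>K i\<^esub> \<in> carrier (K i)" if "i \<in> I" for i
    using assms that hom_one is_group by (blast, simp add: group.is_monoid)
  let ?x = "\<lambda>i\<in>I. if i = j then x else \<one>\<^bsub>K i\<^esub>"
  have "(\<Otimes>i\<in>I. h i (?x i)) = (\<Otimes>i\<in>I. if i = j then h i x else \<one>)"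
    using one assms x by (intro finprod_cong') (auto simp: hom_def Pi_iff)
  also have "\<dots> = (\<Otimes>i\<in>I. if i = j then (\<lambda>_. h j x) i else \<one>)"
    using assms x by (intro finprod_cong') (auto simp: hom_def Pi_iff)
  also have "\<dots> = h j x"
    using assms x by (intro finprod_singleton_swap) (auto simp: hom_def Pi_iff)
  finally have "z = (\<Otimes>i\<in>I. h i (?x i))" using x by simp
  moreover have "?x \<in> carrier (product_group I K)"
    using x one assms(4) by auto
  ultimately show "z \<in> (\<lambda>x. \<Otimes>i\<in>I. h i (x i)) ` carrier (product_group I K)" by blast
qed

lemma iso_of_surj_hom_card:
  assumes "h \<in> hom G K" "h ` carrier G = carrier K" "order G = order K" "finite (carrier G)"
  shows "h \<in> iso G K"
  using assms eq_card_imp_inj_on[of "carrier G" h]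
  by (simp add: iso_def bij_betw_def Coset.order_def)

lemma order_DirProd: "order (G \<times>\<times> K) = order G * order K"
  by (simp add: Coset.order_def card_cartesian_product)

lemma order_integer_mod_group: "m > 0 \<Longrightarrow> order (integer_mod_group m) = m"
  by (simp add: Coset.order_def carrier_integer_mod_group)

lemma order_group_power: "order (group_power G m) = order G ^ m"
  by (simp add: Coset.order_def group_power_def card_PiE)

section \<open>Homomorphisms out of a free module\<close>

context ring_and_group
begin

lemma hom_group_finsum:
  assumes "\<phi> \<in> carrier H" "finite I" "g \<in> I \<rightarrow> carrier R"
  shows "\<phi> (finsum R g I) = finprod P (\<lambda>i. \<phi> (g i)) I"
  using assms(2,3)
proof (induction I)
  case empty
  show ?case using assms(1) by (simp add: hom_groupD)
next
  case (insert i I)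
  have "\<phi> (finsum R g (insert i I)) = \<phi> (g i \<oplus>\<^bsub>R\<^esub> finsum R g I)"
    using insert by (subst R.finsum_insert) auto
  also have "\<dots> = \<phi> (g i) \<otimes>\<^bsub>P\<^esub> \<phi> (finsum R g I)"
    using insert assms(1) by (intro hom_groupD) auto
  also have "\<dots> = \<phi> (g i) \<otimes>\<^bsub>P\<^esub> finprod P (\<lambda>i. \<phi> (g i)) I"
    using insert by auto
  also have "\<dots> = finprod P (\<lambda>i. \<phi> (g i)) (insert i I)"
    using insert assms(1) by (subst P.finprod_insert) (auto simp: hom_groupD Pi_iff)
  finally show ?case .
qed

lemma hom_group_add_pow:
  assumes "\<phi> \<in> carrier H" "x \<in> carrier R"
  shows "\<phi> ([(k :: int)] \<cdot>\<^bsub>R\<^esub> x) = \<phi> x [^]\<^bsub>P\<^esub> k"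
proof -
  interpret \<phi>: group_hom "add_monoid R" P \<phi>
    using assms by (intro group_hom.intro R.a_group P.is_group)
      (simp add: group_hom_axioms_def hom_group_def)
  show ?thesis using \<phi>.hom_int_pow[of x k] assms by (simp add: add_pow_def)
qed

text \<open>Let \<open>R\<close> be additively free over the integers modulo \<open>N\<close>, with basis \<open>e\<close>, and let \<open>N\<close> kill \<open>P\<close>. Then
  a homomorphism to \<open>P\<close> is determined by its values on \<open>e\<close>, which are arbitrary.\<close>

lemma hom_group_free_iso:
  fixes N l :: nat and e :: "nat \<Rightarrow> 'a"
  assumes N: "N > 1" and e: "\<And>i. i < l \<Longrightarrow> e i \<in> carrier R"
    and basis: "bij_betw (\<lambda>c. finsum R (\<lambda>i. [(c i :: int)] \<cdot>\<^bsub>R\<^esub> e i) {..<l})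
      ({..<l} \<rightarrow>\<^sub>E {0..<int N}) (carrier R)"
    and R_exp: "\<And>x. x \<in> carrier R \<Longrightarrow> [N] \<cdot>\<^bsub>R\<^esub> x = \<zero>\<^bsub>R\<^esub>"
    and P_exp: "\<And>y. y \<in> carrier P \<Longrightarrow> y [^]\<^bsub>P\<^esub> N = \<one>\<^bsub>P\<^esub>"
  shows "H \<cong> group_power P l"
proof (rule is_isoI)
  define B where "B c = finsum R (\<lambda>i. [(c i :: int)] \<cdot>\<^bsub>R\<^esub> e i) {..<l}" for c
  let ?C = "{..<l} \<rightarrow>\<^sub>E {0..<int N}"
  \<comment> \<open>\<open>\<kappa>\<close> gives the coordinates of an element, \<open>T\<close> below evaluates a homomorphism on the basis, and
    \<open>S\<close> extends given values on the basis.\<close>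
  define \<kappa> where "\<kappa> = inv_into ?C B"
  have bij: "bij_betw B ?C (carrier R)" using basis by (simp add: B_def[abs_def])
  have \<kappa>: "\<kappa> x \<in> ?C" "B (\<kappa> x) = x" if "x \<in> carrier R" for x
    using inv_into_into[of x B ?C] f_inv_into_f[of x B ?C] bij that
    unfolding \<kappa>_def bij_betw_def by blast+
  have \<kappa>_B: "\<kappa> (B c) = c" if "c \<in> ?C" for c
    using inv_into_f_f[of B ?C c] bij that unfolding \<kappa>_def bij_betw_def by blast
  have R_mod: "[(k mod int N)] \<cdot>\<^bsub>R\<^esub> x = [(k :: int)] \<cdot>\<^bsub>R\<^esub> x" if "x \<in> carrier R" for k x
    using R.add.int_pow_mod[of x N k] R_exp that by simp
  have P_mod: "y [^]\<^bsub>P\<^esub> (k mod int N) = y [^]\<^bsub>P\<^esub> (k :: int)" if "y \<in> carrier P" for k y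
    using P.int_pow_mod P_exp that by simp
  have \<kappa>_add: "\<kappa> (x \<oplus>\<^bsub>R\<^esub> y) i = (\<kappa> x i + \<kappa> y i) mod int N"
    if xy: "x \<in> carrier R" "y \<in> carrier R" "i < l" for x y i
  proof -
    define c where "c = (\<lambda>i\<in>{..<l}. (\<kappa> x i + \<kappa> y i) mod int N)"
    have c: "c \<in> ?C" using N by (auto simp: c_def)
    have "B c = finsum R (\<lambda>i. [(\<kappa> x i)] \<cdot>\<^bsub>R\<^esub> e i \<oplus>\<^bsub>R\<^esub> [(\<kappa> y i)] \<cdot>\<^bsub>R\<^esub> e i) {..<l}"
      unfolding B_def c_def using e by (intro R.finsum_cong') (auto simp: R_mod R.add.int_pow_mult)
    also have "\<dots> = B (\<kappa> x) \<oplus>\<^bsub>R\<^esub> B (\<kappa> y)"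
      unfolding B_def using e by (intro R.finsum_addf) auto
    also have "\<dots> = x \<oplus>\<^bsub>R\<^esub> y" using \<kappa> xy by simp
    finally have "\<kappa> (x \<oplus>\<^bsub>R\<^esub> y) = c" using \<kappa>_B[OF c] by simp
    then show ?thesis using xy by (simp add: c_def)
  qed
  have \<kappa>_e: "\<kappa> (e i) = (\<lambda>j\<in>{..<l}. if j = i then 1 else 0)" if i: "i < l" for i
  proof -
    let ?c = "\<lambda>j\<in>{..<l}. if j = i then 1 else 0 :: int"
    have c: "?c \<in> ?C" using N by auto
    have "B ?c = finsum R (\<lambda>j. if j = i then e j else \<zero>\<^bsub>R\<^esub>) {..<l}"
      unfolding B_def using e by (intro R.finsum_cong') (auto simp: add_pow_int_ge)
    also have "\<dots> = e i" using e i by (intro R.add.finprod_singleton_swap) auto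
    finally show ?thesis using \<kappa>_B[OF c] by simp
  qed
  define T where "T \<phi> = (\<lambda>i\<in>{..<l}. \<phi> (e i))" for \<phi> :: "'a \<Rightarrow> 'p"
  define S where "S m = (\<lambda>x\<in>carrier R. finprod P (\<lambda>i. m i [^]\<^bsub>P\<^esub> \<kappa> x i) {..<l})"
    for m :: "nat \<Rightarrow> 'p"
  have S: "S m \<in> carrier H" if m: "m \<in> {..<l} \<rightarrow>\<^sub>E carrier P" for m
  proof (rule hom_groupI)
    show "S m \<in> extensional (carrier R)" by (simp add: S_def)
    show "S m x \<in> carrier P" if "x \<in> carrier R" for x
      using m that by (auto simp: S_def intro!: P.finprod_closed)
    fix x y assume xy: "x \<in> carrier R" "y \<in> carrier R"
    have "finprod P (\<lambda>i. m i [^]\<^bsub>P\<^esub> \<kappa> (x \<oplus>\<^bsub>R\<^esub> y) i) {..<l} = finprod P (\<lambda>i. m i [^]\<^bsub>P\<^esub> \<kappa> x i \<otimes>\<^bsub>P\<^esub> m i [^]\<^bsub>P\<^esub> \<kappa> y i) {..<l}"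
      using xy m by (intro P.finprod_cong') (auto simp: \<kappa>_add P_mod P.int_pow_mult PiE_iff)
    also have "\<dots> = S m x \<otimes>\<^bsub>P\<^esub> S m y"
      using xy m by (subst P.finprod_multf) (auto simp: S_def simp del: P.finprod_multf)
    finally show "S m (x \<oplus>\<^bsub>R\<^esub> y) = S m x \<otimes>\<^bsub>P\<^esub> S m y" using xy by (simp add: S_def)
  qed
  have "bij_betw T (carrier H) ({..<l} \<rightarrow>\<^sub>E carrier P)"
  proof (rule bij_betwI[where g = S])
    show "T \<in> carrier H \<rightarrow> ({..<l} \<rightarrow>\<^sub>E carrier P)" using e by (auto simp: T_def hom_groupD)
    show "S \<in> ({..<l} \<rightarrow>\<^sub>E carrier P) \<rightarrow> carrier H" using S by blast
    show "S (T \<phi>) = \<phi>" if \<phi>: "\<phi> \<in> carrier H" for \<phi>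
    proof (rule hom_group_ext[OF S \<phi>])
      show "T \<phi> \<in> {..<l} \<rightarrow>\<^sub>E carrier P" using e \<phi> by (auto simp: T_def hom_groupD)
      fix x assume x: "x \<in> carrier R"
      have "S (T \<phi>) x = finprod P (\<lambda>i. \<phi> ([(\<kappa> x i)] \<cdot>\<^bsub>R\<^esub> e i)) {..<l}"
        using x e \<phi> by (auto simp: S_def T_def hom_group_add_pow hom_groupD intro!: P.finprod_cong')
      also have "\<dots> = \<phi> (B (\<kappa> x))"
        unfolding B_def using e by (intro hom_group_finsum[OF \<phi>, symmetric]) auto
      finally show "S (T \<phi>) x = \<phi> x" using \<kappa> x by simp
    qed
    show "T (S m) = m" if m: "m \<in> {..<l} \<rightarrow>\<^sub>E carrier P" for m
    proof (rule extensionalityI[of _ "{..<l}"])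
      fix i assume i: "i \<in> {..<l}"
      have "T (S m) i = finprod P (\<lambda>j. if j = i then m j else \<one>\<^bsub>P\<^esub>) {..<l}"
        using i m e by (auto simp: T_def S_def \<kappa>_e PiE_iff intro!: P.finprod_cong')
      also have "\<dots> = m i" using i m by (intro P.finprod_singleton_swap) auto
      finally show "T (S m) i = m i" .
    qed (use m in \<open>auto simp: T_def PiE_iff\<close>)
  qed
  moreover have "T \<in> hom H (group_power P l)"
    using e by (intro homI)
      (auto simp: T_def group_power_def hom_groupD hom_group_mult intro!: restrict_ext)
  ultimately show "T \<in> iso H (group_power P l)"
    by (simp add: iso_def group_power_def)
qed

end

section \<open>Copies of finite local rings on the natural numbers\<close>

lemma ring_hom_Units:
  assumes "cring A" "g \<in> ring_hom A B" "x \<in> Units A"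
  shows "g x \<in> Units B"
proof -
  interpret A: cring A by fact
  have x: "x \<in> carrier A" "inv\<^bsub>A\<^esub> x \<in> carrier A" using assms(3) by auto
  have "g (inv\<^bsub>A\<^esub> x) \<otimes>\<^bsub>B\<^esub> g x = \<one>\<^bsub>B\<^esub>" "g x \<otimes>\<^bsub>B\<^esub> g (inv\<^bsub>A\<^esub> x) = \<one>\<^bsub>B\<^esub>"
    using x assms(3) ring_hom_mult[OF assms(2)] ring_hom_one[OF assms(2)]
    by (metis A.Units_l_inv, metis A.Units_r_inv)
  then show ?thesis
    using x ring_hom_closed[OF assms(2)] unfolding Units_def by blast
qed

lemma units_of_ring_iso:
  assumes "cring A" "cring B" "g \<in> ring_iso A B"
  shows "units_of A \<cong> units_of B"
proof (rule is_isoI)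
  interpret A: cring A by fact
  interpret B: cring B by fact
  define k where "k = inv_into (carrier A) g"
  have k: "k \<in> ring_iso B A" unfolding k_def by (rule ring_iso_set_sym[OF A.ring_axioms assms(3)])
  have hom: "g \<in> ring_hom A B" "k \<in> ring_hom B A"
    using assms(3) k by (auto simp: ring_iso_def)
  have bij: "bij_betw g (carrier A) (carrier B)" using assms(3) by (simp add: ring_iso_def)
  have gk: "g (k y) = y" if "y \<in> carrier B" for y
    using bij that unfolding k_def by (simp add: bij_betw_def f_inv_into_f)
  have "bij_betw g (Units A) (Units B)"
  proof (rule bij_betw_imageI)
    show "inj_on g (Units A)"
      using bij A.Units_closed unfolding bij_betw_def by (meson inj_on_subset subsetI)
    show "g ` Units A = Units B"
    proof (intro equalityI subsetI)
      show "y \<in> g ` Units A" if "y \<in> Units B" for y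
        using gk[OF B.Units_closed[OF that]] ring_hom_Units[OF assms(2) hom(2) that] by force
    qed (use ring_hom_Units[OF assms(1) hom(1)] in blast)
  qed
  then show "g \<in> iso (units_of A) (units_of B)"
    using ring_hom_mult[OF hom(1)] ring_hom_Units[OF assms(1) hom(1)]
    by (auto simp: iso_def hom_def units_of_def)
qed

lemma finite_local_ring_nat_copy:
  assumes "cring A" "finite (carrier A)" "field F" "\<sigma> \<in> ring_hom A F"
    and units: "\<And>x. x \<in> carrier A \<Longrightarrow> \<sigma> x \<noteq> \<zero>\<^bsub>F\<^esub> \<Longrightarrow> x \<in> Units A"
  shows "\<exists>B :: nat ring. local_cring B \<and> artinian_cring B \<and> units_of A \<cong> units_of B"
proof -
  interpret A: cring A by fact
  obtain g :: "'a \<Rightarrow> nat" where g: "inj_on g (carrier A)"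
    using finite_imp_inj_to_nat_seg[OF assms(2)] by blast
  define B where "B = image_ring g A"
  have iso: "g \<in> ring_iso A B" unfolding B_def by (rule inj_imp_image_ring_iso[OF g])
  have "cring B"
    using A.ring_iso_imp_img_cring[OF iso]
    by (simp add: B_def image_ring_def image_group_def monoid.defs)
  interpret B: cring B by fact
  define k where "k = inv_into (carrier A) g"
  have "k \<in> ring_iso B A" unfolding k_def by (rule ring_iso_set_sym[OF A.ring_axioms iso])
  then have k: "k \<in> ring_hom B A" by (simp add: ring_iso_def)
  have carrier_B: "carrier B = g ` carrier A" by (simp add: B_def image_ring_carrier)
  have "local_cring B"
  proof (rule local_cringI_residue_hom[OF \<open>cring B\<close> \<open>field F\<close>])
    show "\<sigma> \<circ> k \<in> ring_hom B F" by (rule ring_hom_trans[OF k assms(4)])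
    fix y assume y: "y \<in> carrier B" "(\<sigma> \<circ> k) y \<noteq> \<zero>\<^bsub>F\<^esub>"
    then have ky: "k y \<in> Units A" using units[OF ring_hom_closed[OF k y(1)]] by simp
    have "g \<in> ring_hom A B" using iso by (simp add: ring_iso_def)
    from ring_hom_Units[OF \<open>cring A\<close> this ky] have "g (k y) \<in> Units B" .
    moreover have "g (k y) = y"
      using y(1) f_inv_into_f[of y g "carrier A"] unfolding k_def carrier_B by blast
    ultimately show "y \<in> Units B" by simp
  qed
  moreover have "artinian_cring B"
    using assms(2) by (intro artinian_cringI_finite[OF \<open>cring B\<close>]) (simp add: carrier_B)
  moreover have "units_of A \<cong> units_of B"
    by (rule units_of_ring_iso[OF \<open>cring A\<close> \<open>cring B\<close> iso])
  ultimately show ?thesis by blast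
qed

section \<open>The Galois ring\<close>

text \<open>The quotient of the integer polynomials by \<open>(2^n, f)\<close>. It is a Galois ring when \<open>n \<ge> 1\<close> and
  \<open>f\<close> is monic and irreducible modulo two.\<close>

definition galois_ring :: "int poly \<Rightarrow> nat \<Rightarrow> int poly set ring"
  where "galois_ring f n = int_poly_ring Quot two_pow_ideal f n"

text \<open>The quotient map onto \<open>galois_ring f n\<close>.\<close>

definition galois_proj :: "int poly \<Rightarrow> nat \<Rightarrow> int poly \<Rightarrow> int poly set"
  where "galois_proj f n p = two_pow_ideal f n +>\<^bsub>int_poly_ring\<^esub> p"

lemma int_poly_ring_simps [simp]:
  "carrier int_poly_ring = UNIV" "p \<otimes>\<^bsub>int_poly_ring\<^esub> q = p * q" "\<one>\<^bsub>int_poly_ring\<^esub> = 1"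
  "\<zero>\<^bsub>int_poly_ring\<^esub> = 0" "p \<oplus>\<^bsub>int_poly_ring\<^esub> q = p + q"
  by (simp_all add: ring_of_type_algebra_def)

lemma ideal_two_pow_ideal: "ideal (two_pow_ideal f n) int_poly_ring"
proof -
  interpret Z: cring int_poly_ring by (rule cring_from_type_algebra)
  have inv: "\<ominus>\<^bsub>int_poly_ring\<^esub> x = - x" for x
    using Z.minus_equality[of "- x" x] by simp
  show ?thesis
  proof (rule idealI[OF Z.ring_axioms])
    show "subgroup (two_pow_ideal f n) (add_monoid int_poly_ring)"
      by (rule Z.add.subgroupI)
         (auto simp: inv intro: two_pow_ideal_add two_pow_ideal_uminus two_pow_ideal_zero)
  qed (auto intro: two_pow_ideal_mult two_pow_ideal_mult_right)
qed

lemma cring_galois_ring: "cring (galois_ring f n)"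
  unfolding galois_ring_def
  by (intro ideal.quotient_is_cring[OF ideal_two_pow_ideal] cring_from_type_algebra)

lemma galois_proj_hom: "galois_proj f n \<in> ring_hom int_poly_ring (galois_ring f n)"
  unfolding galois_ring_def galois_proj_def[abs_def]
  by (rule ideal.rcos_ring_hom[OF ideal_two_pow_ideal])

lemma carrier_galois_ring: "carrier (galois_ring f n) = range (galois_proj f n)"
  by (auto simp: galois_ring_def FactRing_def A_RCOSETS_def' galois_proj_def)

lemma galois_proj_eq_iff: "galois_proj f n p = galois_proj f n q \<longleftrightarrow> two_pow_cong f n p q"
proof -
  have mem: "x \<in> galois_proj f n p \<longleftrightarrow> two_pow_cong f n x p" for x p
  proof -
    have "x \<in> galois_proj f n p \<longleftrightarrow> (\<exists>h\<in>two_pow_ideal f n. x = h + p)"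
      by (auto simp: galois_proj_def a_r_coset_def')
    also have "\<dots> \<longleftrightarrow> two_pow_cong f n x p"
      unfolding two_pow_cong_def by (metis add_diff_cancel_right' diff_add_cancel)
    finally show ?thesis .
  qed
  show ?thesis
  proof
    assume "galois_proj f n p = galois_proj f n q"
    then show "two_pow_cong f n p q" using mem[of p p] mem[of p q] by simp
  next
    assume "two_pow_cong f n p q"
    then show "galois_proj f n p = galois_proj f n q"
      using two_pow_cong_trans two_pow_cong_sym by (fastforce simp: mem)
  qed
qed

lemma galois_proj_closed [simp]: "galois_proj f n p \<in> carrier (galois_ring f n)"
  by (simp add: carrier_galois_ring)

lemma galois_proj_mult: "galois_proj f n (p * q) = galois_proj f n p \<otimes>\<^bsub>galois_ring f n\<^esub> galois_proj f n q"
  and galois_proj_add: "galois_proj f n (p + q) = galois_proj f n p \<oplus>\<^bsub>galois_ring f n\<^esub> galois_proj f n q"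
  and galois_proj_1: "galois_proj f n 1 = \<one>\<^bsub>galois_ring f n\<^esub>"
  using ring_hom_mult[OF galois_proj_hom] ring_hom_add[OF galois_proj_hom]
    ring_hom_one[OF galois_proj_hom] by auto

lemma galois_proj_0: "galois_proj f n 0 = \<zero>\<^bsub>galois_ring f n\<^esub>"
proof -
  interpret G: cring "galois_ring f n" by (rule cring_galois_ring)
  show ?thesis
    using galois_proj_add[of f n 0 0] G.add.r_cancel_one[of "galois_proj f n 0" "galois_proj f n 0"]
    by simp
qed

lemma galois_proj_add_pow_nat:
  fixes k :: nat shows
  "[k] \<cdot>\<^bsub>galois_ring f n\<^esub> galois_proj f n p = galois_proj f n (of_nat k * p)"
proof -
  interpret G: cring "galois_ring f n" by (rule cring_galois_ring)
  show ?thesis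
    by (induction k) (simp_all add: galois_proj_0 galois_proj_add distrib_right G.a_comm)
qed

lemma galois_proj_add_pow:
  fixes k :: int
  assumes "k \<ge> 0"
  shows "[k] \<cdot>\<^bsub>galois_ring f n\<^esub> galois_proj f n p = galois_proj f n (of_int k * p)"
  using assms by (simp add: add_pow_int_ge galois_proj_add_pow_nat)

context int_poly_residue
begin

abbreviation "l \<equiv> Polynomial.degree f"

lemma ev_mult [simp]: "ev (p * q) = ev p \<otimes> ev q"
  and ev_add [simp]: "ev (p + q) = ev p \<oplus> ev q"
  and ev_1 [simp]: "ev 1 = \<one>"
  and ev_closed [simp]: "ev p \<in> carrier F"
  using ring_hom_mult[OF ev_hom] ring_hom_add[OF ev_hom]
    ring_hom_one[OF ev_hom] ring_hom_closed[OF ev_hom] by auto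

lemma ev_0 [simp]: "ev 0 = \<zero>"
  by (simp add: ev_kernel)

lemma ev_power [simp]: "ev (p ^ k) = ev p [^] k"
  by (induction k) (simp_all add: F.m_comm)

lemma ev_diff: "ev (p - q) = ev p \<ominus> ev q"
proof -
  have "ev (p - q) \<oplus> ev q = ev p" by (simp flip: ev_add)
  then show ?thesis by (metis F.add.inv_solve_right a_minus_def ev_closed)
qed

lemma ev_eq_iff: "ev p = ev q \<longleftrightarrow> two_pow_cong f 1 p q"
  unfolding two_pow_cong_def ev_kernel[symmetric] ev_diff by simp

lemma bij_betw_galois_proj: "bij_betw (galois_proj f n) (normal_forms l n) (carrier (galois_ring f n))"
proof (rule bij_betw_imageI)
  show "inj_on (galois_proj f n) (normal_forms l n)"
    using normal_form_unique[OF monic refl degree_pos]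
    by (auto intro!: inj_onI simp: galois_proj_eq_iff)
  show "galois_proj f n ` normal_forms l n = carrier (galois_ring f n)"
    using ex_normal_form[OF monic refl degree_pos]
    by (fastforce simp: carrier_galois_ring galois_proj_eq_iff image_iff)
qed

lemma card_galois_ring: "card (carrier (galois_ring f n)) = 2 ^ (n * l)"
  using bij_betw_same_card[OF bij_betw_galois_proj] card_normal_forms by metis

lemma finite_galois_ring: "finite (carrier (galois_ring f n))"
  using bij_betw_finite[OF bij_betw_galois_proj] finite_normal_forms by metis

lemma card_residue_field: "card (carrier F) = 2 ^ l"
proof -
  have "bij_betw ev (normal_forms l 1) (carrier F)"
  proof (rule bij_betw_imageI)
    show "inj_on ev (normal_forms l 1)"
      using normal_form_unique[OF monic refl degree_pos]
      by (auto intro!: inj_onI simp: ev_eq_iff)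
    have "range ev \<subseteq> ev ` normal_forms l 1"
    proof
      fix x assume "x \<in> range ev"
      then obtain p where "x = ev p" by blast
      moreover obtain r where "r \<in> normal_forms l 1" "two_pow_cong f 1 p r"
        using ex_normal_form[OF monic refl degree_pos] by blast
      ultimately show "x \<in> ev ` normal_forms l 1" unfolding ev_eq_iff[symmetric] by blast
    qed
    then show "ev ` normal_forms l 1 = carrier F" using ev_surj by auto
  qed
  from bij_betw_same_card[OF this] show ?thesis by (simp add: card_normal_forms)
qed

lemma finite_residue_field: "finite (carrier F)"
  by (rule card_ge_0_finite) (simp add: card_residue_field)

subsection \<open>The residue map\<close>

text \<open>The map induced by \<open>ev\<close> on the Galois ring. It is independent of the representative for \<open>n \<ge> 1\<close>.\<close>

definition residue :: "nat \<Rightarrow> int poly set \<Rightarrow> 'a"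
  where "residue n r = ev (SOME p. galois_proj f n p = r)"

lemma residue_galois_proj:
  assumes "n \<ge> 1" shows "residue n (galois_proj f n p) = ev p"
proof -
  have "galois_proj f n (SOME q. galois_proj f n q = galois_proj f n p) = galois_proj f n p"
    by (rule someI) simp
  then show ?thesis
    using two_pow_cong_antimono[OF assms]
    by (simp add: residue_def galois_proj_eq_iff ev_eq_iff)
qed

lemma residue_hom:
  assumes "n \<ge> 1" shows "residue n \<in> ring_hom (galois_ring f n) F"
  by (rule ring_hom_memI)
     (use assms in \<open>auto simp: carrier_galois_ring residue_galois_proj
        simp flip: galois_proj_mult galois_proj_add galois_proj_1\<close>)

lemma Units_galois_ring:
  assumes "n \<ge> 1"
  shows "galois_proj f n p \<in> Units (galois_ring f n) \<longleftrightarrow> ev p \<noteq> \<zero>"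
proof
  interpret G: cring "galois_ring f n" by (rule cring_galois_ring)
  assume "galois_proj f n p \<in> Units (galois_ring f n)"
  then obtain y where "y \<in> carrier (galois_ring f n)"
      "galois_proj f n p \<otimes>\<^bsub>galois_ring f n\<^esub> y = \<one>\<^bsub>galois_ring f n\<^esub>"
    using G.Units_r_inv_ex by blast
  then obtain q where "galois_proj f n (p * q) = galois_proj f n 1"
    by (auto simp: carrier_galois_ring galois_proj_mult galois_proj_1)
  then have "ev (p * q) = ev 1"
    using two_pow_cong_antimono[OF assms] by (simp add: galois_proj_eq_iff ev_eq_iff del: ev_mult ev_1)
  then show "ev p \<noteq> \<zero>" by auto
next
  interpret G: cring "galois_ring f n" by (rule cring_galois_ring)
  assume p: "ev p \<noteq> \<zero>"
  then have "ev p \<in> Units F" by (simp add: F.field_Units)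
  then obtain q where q: "ev p \<otimes> ev q = \<one>"
    using F.Units_r_inv_ex ev_surj by (metis rangeE)
  have "two_pow_cong f 1 (p * q) 1" using q unfolding ev_eq_iff[symmetric] by simp
  from two_pow_cong_power_two_pow[OF this, of "n - 1"] assms
  have "two_pow_cong f n ((p * q) ^ 2 ^ (n - 1)) 1" by simp
  moreover have "(p * q) ^ 2 ^ (n - 1) = p * (q * (p * q) ^ (2 ^ (n - 1) - 1))"
    by (metis mult.assoc power_eq_if power_not_zero zero_neq_numeral)
  ultimately have "galois_proj f n p \<otimes>\<^bsub>galois_ring f n\<^esub>
      galois_proj f n (q * (p * q) ^ (2 ^ (n - 1) - 1)) = \<one>\<^bsub>galois_ring f n\<^esub>"
    by (simp add: galois_proj_eq_iff flip: galois_proj_mult galois_proj_1)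
  then have "galois_proj f n p \<otimes>\<^bsub>galois_ring f n\<^esub>
      galois_proj f n (q * (p * q) ^ (2 ^ (n - 1) - 1)) \<in> Units (galois_ring f n)"
    by (simp only: G.Units_one_closed)
  then show "galois_proj f n p \<in> Units (galois_ring f n)"
    by (rule G.unit_factor[OF _ galois_proj_closed galois_proj_closed])
qed

text \<open>The units are the elements outside the kernel of the residue map, and that kernel has
  \<open>2 ^ ((n - 1) * l)\<close> elements.\<close>

lemma card_Units_galois_ring:
  assumes "n \<ge> 1"
  shows "card (Units (galois_ring f n)) = (2 ^ l - 1) * 2 ^ ((n - 1) * l)"
proof -
  let ?G = "galois_ring f n"
  interpret G: cring ?G by (rule cring_galois_ring)
  interpret res: group_hom "add_monoid ?G" "add_monoid F" "residue n"
    by (intro group_hom.intro G.a_group F.a_group)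
       (auto simp: group_hom_axioms_def hom_def ring_hom_closed[OF residue_hom[OF assms]]
          ring_hom_add[OF residue_hom[OF assms]])
  let ?K = "kernel (add_monoid ?G) (add_monoid F) (residue n)"
  have im: "residue n ` carrier ?G = carrier F"
    using assms ev_surj by (simp add: carrier_galois_ring image_image residue_galois_proj)
  have "2 ^ l * card ?K = 2 ^ (n * l)"
    using res.card_image_times_kernel finite_galois_ring im
    by (simp add: Coset.order_def card_galois_ring card_residue_field)
  also have "n * l = l + (n - 1) * l" using assms by (simp add: algebra_simps mult_eq_if)
  finally have K: "card ?K = 2 ^ ((n - 1) * l)" by (simp add: power_add)
  have "Units ?G = carrier ?G - ?K"
    using assms by (auto simp: kernel_def carrier_galois_ring Units_galois_ring residue_galois_proj
        dest: G.Units_closed)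
  moreover have "?K \<subseteq> carrier ?G" by (auto simp: kernel_def)
  ultimately have "card (Units ?G) = card (carrier ?G) - card ?K"
    using finite_galois_ring by (simp add: card_Diff_subset finite_subset)
  also have "card (carrier ?G) = 2 ^ l * 2 ^ ((n - 1) * l)"
    using \<open>n * l = l + (n - 1) * l\<close> by (simp add: card_galois_ring power_add)
  finally show ?thesis using K by (simp add: diff_mult_distrib)
qed

end

section \<open>The unit group of the Galois ring\<close>

context int_poly_residue
begin

lemma ex_artin_schreier_poly:
  "\<exists>v\<^sub>0. \<forall>v. \<exists>(c::nat) w. two_pow_cong f 1 v (of_nat c * v\<^sub>0 + (w + w\<^sup>2))"
proof -
  have "order F = 2 ^ l" by (simp add: Coset.order_def card_residue_field)
  from F.artin_schreier_char_two[OF finite_residue_field F.char_two_of_order[OF this]]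
  obtain \<alpha> where \<alpha>: "\<alpha> \<in> carrier F"
      "\<And>x. x \<in> carrier F \<Longrightarrow> \<exists>c\<in>{\<zero>, \<alpha>}. \<exists>y\<in>carrier F. x = c \<oplus> (y \<oplus> y \<otimes> y)"
    by blast
  obtain v\<^sub>0 where v\<^sub>0: "ev v\<^sub>0 = \<alpha>" using \<alpha>(1) ev_surj by (metis rangeE)
  have "\<exists>(c::nat) w. two_pow_cong f 1 v (of_nat c * v\<^sub>0 + (w + w\<^sup>2))" for v
  proof -
    obtain c y where c: "c \<in> {\<zero>, \<alpha>}" and y: "y \<in> carrier F" "ev v = c \<oplus> (y \<oplus> y \<otimes> y)"
      using \<alpha>(2)[OF ev_closed[of v]] by blast
    obtain w where w: "ev w = y" using y(1) ev_surj by (metis rangeE)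
    obtain k :: nat where k: "c = ev (of_nat k * v\<^sub>0)"
    proof (cases "c = \<zero>")
      case True
      then show ?thesis using that[of 0] by simp
    next
      case False
      then show ?thesis using that[of 1] c v\<^sub>0 by simp
    qed
    have "ev v = ev (of_nat k * v\<^sub>0 + (w + w\<^sup>2))"
      using y w k by (simp add: power2_eq_square)
    then show ?thesis unfolding ev_eq_iff by blast
  qed
  then show ?thesis by blast
qed

text \<open>
  Lifts of a basis of the residue field over the prime field. The lift of \<open>1\<close> is \<open>-1\<close>, so that the
  principal unit \<open>1 + 2 * lift_basis 0 = -1\<close> has order two.
\<close>

definition lift_basis :: "nat \<Rightarrow> int poly"
  where "lift_basis i = (if i = 0 then -1 else Polynomial.monom 1 i)"

lemma lift_basis_span: "\<exists>J\<subseteq>{..<l}. two_pow_cong f 1 v (\<Sum>i\<in>J. lift_basis i)"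
proof -
  obtain r where r: "r \<in> normal_forms l 1" "two_pow_cong f 1 v r"
    using ex_normal_form[OF monic refl degree_pos] by blast
  define J where "J = {i. i < l \<and> Polynomial.coeff r i = 1}"
  have c: "Polynomial.coeff r i = (if i \<in> J then 1 else 0)" for i
  proof -
    have "Polynomial.coeff r i \<in> {0..<2}" "i \<ge> l \<longrightarrow> Polynomial.coeff r i = 0"
      using r(1) by (auto simp: normal_forms_def)
    then show ?thesis by (auto simp: J_def)
  qed
  have "finite J" by (simp add: J_def)
  then have "r = (\<Sum>i\<in>J. Polynomial.monom 1 i)"
    by (intro poly_eqI) (simp add: c Polynomial.coeff_sum Polynomial.coeff_monom)
  moreover have "two_pow_cong f 1 (\<Sum>i\<in>J. Polynomial.monom 1 i) (\<Sum>i\<in>J. lift_basis i)"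
  proof (rule two_pow_cong_sum)
    fix i
    show "two_pow_cong f 1 (Polynomial.monom 1 i) (lift_basis i)"
      using two_pow_mem[of 1 1 1 f]
      by (auto simp: lift_basis_def two_pow_cong_def monom_0 simp flip: one_pCons)
  qed
  ultimately have "two_pow_cong f 1 v (\<Sum>i\<in>J. lift_basis i)"
    using r(2) two_pow_cong_trans by blast
  moreover have "J \<subseteq> {..<l}" by (auto simp: J_def)
  ultimately show ?thesis by blast
qed

text \<open>The multiplicative section of the residue map on the units: any lift of \<open>a\<close>, raised to a power of
  the order \<open>2 ^ l\<close> of the field that is large enough for the choice of the lift to be irrelevant
  modulo \<open>2 ^ n\<close>. That power fixes the residue class.\<close>

definition teichmueller :: "nat \<Rightarrow> 'a \<Rightarrow> int poly set"
  where "teichmueller n a = galois_proj f n ((SOME p. ev p = a) ^ 2 ^ (l * n))"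

lemma teichmueller_ev:
  assumes "n \<ge> 1" shows "teichmueller n (ev p) = galois_proj f n (p ^ 2 ^ (l * n))"
proof -
  have "ev (SOME q. ev q = ev p) = ev p" by (rule someI) simp
  then have "two_pow_cong f 1 (SOME q. ev q = ev p) p" by (simp only: ev_eq_iff)
  from two_pow_cong_power_two_pow[OF this, of "l * n"]
  have "two_pow_cong f (1 + l * n) ((SOME q. ev q = ev p) ^ 2 ^ (l * n)) (p ^ 2 ^ (l * n))" by simp
  moreover have "n \<le> 1 + l * n" using degree_pos by (cases l) auto
  ultimately show ?thesis
    unfolding teichmueller_def galois_proj_eq_iff using two_pow_cong_antimono by blast
qed

lemma frobenius_power:
  assumes "x \<in> carrier F" shows "x [^] ((2::nat) ^ (l * n)) = x"
proof (induction n)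
  case (Suc n)
  have step: "x [^] ((2::nat) ^ l) = x"
  proof (cases "x = \<zero>")
    case True
    then show ?thesis by (simp add: F.nat_pow_zero)
  next
    case False
    then have x: "x \<in> Units F" using assms by (simp add: F.field_Units)
    interpret U: comm_group "units_of F" by (rule F.units_comm_group)
    have ord: "order (units_of F) = 2 ^ l - 1"
      using finite_residue_field
      by (simp add: Coset.order_def units_of_carrier F.field_Units card_residue_field card_Diff_singleton)
    have "x [^] ((2::nat) ^ l - 1) = \<one>"
      using U.pow_order_eq_1[of x] x by (simp add: ord units_of_carrier units_of_one F.units_of_pow)
    moreover have "(2::nat) ^ l = Suc (2 ^ l - 1)" by simp
    ultimately show ?thesis using assms by (metis F.nat_pow_Suc F.l_one)
  qed
  have "x [^] ((2::nat) ^ (l * Suc n)) = (x [^] ((2::nat) ^ (l * n))) [^] ((2::nat) ^ l)"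
    using assms by (simp add: F.nat_pow_pow power_add[symmetric] add.commute)
  then show ?case using Suc step by simp
qed (use assms in simp)

text \<open>
  The isomorphism is the product of the Teichmueller lift and of the power maps for \<open>-1\<close>,
  \<open>1 + 4 * v\<^sub>0\<close> and the \<open>1 + 2 * lift_basis i\<close> with \<open>0 < i < l\<close>. It is surjective by
  \<open>unit_filtration\<close>, and both groups have the same order.
\<close>

lemma units_galois_ring_iso:
  assumes n: "n \<ge> 2"
  shows "units_of F \<times>\<times> integer_mod_group 2 \<times>\<times> integer_mod_group (2 ^ (n - 2))
      \<times>\<times> group_power (integer_mod_group (2 ^ (n - 1))) (l - 1) \<cong> units_of (galois_ring f n)"
proof -
  have n1: "n \<ge> 1" using n by simp
  define G where "G = units_of (galois_ring f n)"
  interpret R: cring "galois_ring f n" by (rule cring_galois_ring)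
  interpret G: comm_group G unfolding G_def by (rule R.units_comm_group)
  interpret UF: comm_group "units_of F" by (rule F.units_comm_group)
  let ?U = "galois_proj f n"
  have U_closed: "?U p \<in> carrier G" if "ev p \<noteq> \<zero>" for p
    using Units_galois_ring[OF n1] that by (simp add: G_def units_of_carrier)
  have U_mult: "?U (p * q) = ?U p \<otimes>\<^bsub>G\<^esub> ?U q" for p q
    by (simp add: G_def units_of_mult galois_proj_mult)
  have U_1: "?U 1 = \<one>\<^bsub>G\<^esub>" by (simp add: G_def units_of_one galois_proj_1)
  have U_pow: "?U (p ^ k) = ?U p [^]\<^bsub>G\<^esub> k" if "ev p \<noteq> \<zero>" for p k
    using that
    by (induction k) (simp_all add: U_1 U_mult U_closed G.m_comm)
  have ev1: "ev (1 + 2 * y) = \<one>" for y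
  proof -
    have "two_pow_cong f 1 (1 + 2 * y) 1" using two_pow_mem[of 1 1 y f] by (simp add: two_pow_cong_def)
    then have "ev (1 + 2 * y) = ev 1" unfolding ev_eq_iff .
    then show ?thesis by simp
  qed
  have ev1_ne: "ev (1 + 2 * y) \<noteq> \<zero>" for y using ev1[of y] by simp
  have U1: "?U (1 + 2 * y) \<in> carrier G" for y using U_closed[OF ev1_ne] .
  have U1_order: "?U (1 + 2 * y) [^]\<^bsub>G\<^esub> ((2::nat) ^ (n - 1)) = \<one>\<^bsub>G\<^esub>" for y
  proof -
    have "two_pow_cong f 1 (1 + 2 * y) 1" using two_pow_mem[of 1 1 y f] by (simp add: two_pow_cong_def)
    from two_pow_cong_power_two_pow[OF this, of "n - 1"]
    have "two_pow_cong f n ((1 + 2 * y) ^ 2 ^ (n - 1)) 1" using n by simp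
    then show ?thesis using U_pow[OF ev1_ne] U_1 by (metis galois_proj_eq_iff)
  qed
  obtain v\<^sub>0 where v\<^sub>0: "\<And>v. \<exists>(c::nat) w. two_pow_cong f 1 v (of_nat c * v\<^sub>0 + (w + w\<^sup>2))"
    using ex_artin_schreier_poly by blast
  define g\<^sub>0 where "g\<^sub>0 = ?U (1 + 2 * lift_basis 0)"
  define g\<^sub>1 where "g\<^sub>1 = ?U (1 + 4 * v\<^sub>0)"
  define g where "g i = ?U (1 + 2 * lift_basis (Suc i))" for i
  have four: "1 + 4 * v\<^sub>0 = 1 + 2 * (2 * v\<^sub>0)" by simp
  have g_closed: "g\<^sub>0 \<in> carrier G" "g\<^sub>1 \<in> carrier G" "g i \<in> carrier G" for i
    unfolding g\<^sub>0_def g\<^sub>1_def g_def four by (rule U1)+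
  have g\<^sub>0_order: "g\<^sub>0 [^]\<^bsub>G\<^esub> (2::nat) = \<one>\<^bsub>G\<^esub>"
    unfolding g\<^sub>0_def U_pow[OF ev1_ne, symmetric] by (simp add: lift_basis_def U_1)
  have g\<^sub>1_order: "g\<^sub>1 [^]\<^bsub>G\<^esub> ((2::nat) ^ (n - 2)) = \<one>\<^bsub>G\<^esub>"
  proof -
    have "two_pow_cong f 2 (1 + 4 * v\<^sub>0) 1" using two_pow_mem[of 2 2 v\<^sub>0 f] by (simp add: two_pow_cong_def)
    from two_pow_cong_power_two_pow[OF this, of "n - 2"]
    have "two_pow_cong f n ((1 + 4 * v\<^sub>0) ^ 2 ^ (n - 2)) 1"
      using n by (simp only: power_one le_add_diff_inverse)
    then have "?U ((1 + 4 * v\<^sub>0) ^ 2 ^ (n - 2)) = \<one>\<^bsub>G\<^esub>"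
      unfolding U_1[symmetric] galois_proj_eq_iff .
    then show ?thesis unfolding g\<^sub>1_def four U_pow[OF ev1_ne, symmetric] .
  qed
  have g_order: "g i [^]\<^bsub>G\<^esub> ((2::nat) ^ (n - 1)) = \<one>\<^bsub>G\<^esub>" for i
    unfolding g_def by (rule U1_order)
  let ?Z = "\<lambda>k. integer_mod_group (2 ^ k)"
  let ?W = "group_power (?Z (n - 1)) (l - 1)"
  define h\<^sub>0 where "h\<^sub>0 k = g\<^sub>0 [^]\<^bsub>G\<^esub> k" for k :: int
  define h\<^sub>1 where "h\<^sub>1 k = g\<^sub>1 [^]\<^bsub>G\<^esub> k" for k :: int
  define h\<^sub>2 where "h\<^sub>2 x = finprod G (\<lambda>i. g i [^]\<^bsub>G\<^esub> x i) {..<l - 1}" for x :: "nat \<Rightarrow> int"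
  define k\<^sub>1 where "k\<^sub>1 = (\<lambda>(x, y). h\<^sub>1 x \<otimes>\<^bsub>G\<^esub> h\<^sub>2 y)"
  define k\<^sub>0 where "k\<^sub>0 = (\<lambda>(x, y). h\<^sub>0 x \<otimes>\<^bsub>G\<^esub> k\<^sub>1 y)"
  define k where "k = (\<lambda>(x, y). teichmueller n x \<otimes>\<^bsub>G\<^esub> k\<^sub>0 y)"
  have grp: "group (?Z m)" "group ?W" "group (?Z (n - 2) \<times>\<times> ?W)"
      "group (integer_mod_group 2 \<times>\<times> ?Z (n - 2) \<times>\<times> ?W)" for m
    by (simp_all add: group_power_def DirProd_group)
  have hom_h\<^sub>0: "h\<^sub>0 \<in> hom (integer_mod_group 2) G"
    unfolding h\<^sub>0_def[abs_def] by (rule G.integer_mod_group_hom[OF g_closed(1) g\<^sub>0_order])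
  have hom_h\<^sub>1: "h\<^sub>1 \<in> hom (?Z (n - 2)) G"
    unfolding h\<^sub>1_def[abs_def] by (rule G.integer_mod_group_hom[OF g_closed(2) g\<^sub>1_order])
  have hom_g: "(\<lambda>k. g i [^]\<^bsub>G\<^esub> (k :: int)) \<in> hom (?Z (n - 1)) G" for i
    by (rule G.integer_mod_group_hom[OF g_closed(3) g_order])
  have hom_h\<^sub>2: "h\<^sub>2 \<in> hom ?W G"
    unfolding h\<^sub>2_def[abs_def] group_power_def by (rule G.product_group_hom[OF finite_lessThan hom_g])
  have hom_k\<^sub>1: "k\<^sub>1 \<in> hom (?Z (n - 2) \<times>\<times> ?W) G"
    unfolding k\<^sub>1_def by (rule G.DirProd_hom[OF hom_h\<^sub>1 hom_h\<^sub>2])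
  have hom_k\<^sub>0: "k\<^sub>0 \<in> hom (integer_mod_group 2 \<times>\<times> ?Z (n - 2) \<times>\<times> ?W) G"
    unfolding k\<^sub>0_def by (rule G.DirProd_hom[OF hom_h\<^sub>0 hom_k\<^sub>1])
  have hom_teich: "teichmueller n \<in> hom (units_of F) G"
  proof (rule homI)
    fix x assume x: "x \<in> carrier (units_of F)"
    then have "x \<in> carrier F" "x \<noteq> \<zero>" by (auto simp: units_of_carrier F.field_Units)
    moreover obtain p where p: "x = ev p" using \<open>x \<in> carrier F\<close> ev_surj by (metis rangeE)
    ultimately show "teichmueller n x \<in> carrier G"
      unfolding p teichmueller_ev[OF n1] by (intro U_closed) (simp add: frobenius_power)
    fix y assume "y \<in> carrier (units_of F)"
    then have "y \<in> carrier F" by (auto simp: units_of_carrier F.field_Units)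
    then obtain q where q: "y = ev q" using ev_surj by (metis rangeE)
    have "x \<otimes>\<^bsub>units_of F\<^esub> y = ev (p * q)" by (simp add: p q units_of_mult)
    then show "teichmueller n (x \<otimes>\<^bsub>units_of F\<^esub> y) = teichmueller n x \<otimes>\<^bsub>G\<^esub> teichmueller n y"
      by (simp only: p q teichmueller_ev[OF n1] U_mult power_mult_distrib)
  qed
  let ?D\<^sub>0 = "integer_mod_group 2 \<times>\<times> ?Z (n - 2) \<times>\<times> ?W"
  let ?D = "units_of F \<times>\<times> ?D\<^sub>0"
  have hom_k: "k \<in> hom ?D G"
    unfolding k_def by (rule G.DirProd_hom[OF hom_teich hom_k\<^sub>0])
  \<comment> \<open>Representatives of the principal units that the powers of \<open>g\<^sub>0\<close>, \<open>g\<^sub>1\<close> and the \<open>g i\<close> reach.\<close>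
  define S where "S = {p. ev p = \<one> \<and> ?U p \<in> k\<^sub>0 ` carrier ?D\<^sub>0}"
  have g\<^sub>0_im: "g\<^sub>0 \<in> k\<^sub>0 ` carrier ?D\<^sub>0"
    using G.generator_in_image[OF g_closed(1) g\<^sub>0_order]
      G.DirProd_hom_image(1)[OF hom_h\<^sub>0 hom_k\<^sub>1 group_integer_mod_group grp(3)]
    unfolding k\<^sub>0_def h\<^sub>0_def[abs_def] by auto
  have k\<^sub>1_im: "k\<^sub>1 ` carrier (?Z (n - 2) \<times>\<times> ?W) \<subseteq> k\<^sub>0 ` carrier ?D\<^sub>0"
    using G.DirProd_hom_image(2)[OF hom_h\<^sub>0 hom_k\<^sub>1 group_integer_mod_group grp(3)]
    unfolding k\<^sub>0_def .
  have g\<^sub>1_im: "g\<^sub>1 \<in> k\<^sub>1 ` carrier (?Z (n - 2) \<times>\<times> ?W)"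
    using G.generator_in_image[OF g_closed(2) g\<^sub>1_order]
      G.DirProd_hom_image(1)[OF hom_h\<^sub>1 hom_h\<^sub>2 group_integer_mod_group grp(2)]
    unfolding k\<^sub>1_def h\<^sub>1_def[abs_def] by auto
  have g_im: "g i \<in> k\<^sub>1 ` carrier (?Z (n - 2) \<times>\<times> ?W)" if i: "i < l - 1" for i
  proof -
    have "g i \<in> h\<^sub>2 ` carrier ?W"
      using G.generator_in_image[OF g_closed(3) g_order, of i]
        G.product_group_hom_image[of "{..<l - 1}" "\<lambda>i k. g i [^]\<^bsub>G\<^esub> k" "\<lambda>_. ?Z (n - 1)" i] hom_g i
      unfolding h\<^sub>2_def[abs_def] group_power_def by auto
    then show ?thesis
      using G.DirProd_hom_image(2)[OF hom_h\<^sub>1 hom_h\<^sub>2 group_integer_mod_group grp(2)]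
      unfolding k\<^sub>1_def by blast
  qed
  interpret D\<^sub>0: group ?D\<^sub>0 by (rule grp(4))
  interpret k\<^sub>0: group_hom ?D\<^sub>0 G k\<^sub>0
    by (intro group_hom.intro group_hom_axioms.intro hom_k\<^sub>0 G.is_group D\<^sub>0.is_group)
  have S_approx: "\<exists>h\<in>S. two_pow_cong f (Suc (n - 1)) p h" if p: "ev p = \<one>" for p
  proof (rule unit_filtration[where I = "{..<l}" and b = lift_basis and v\<^sub>0 = v\<^sub>0])
    show "1 \<in> S"
      using k\<^sub>0.hom_one D\<^sub>0.one_closed by (simp only: S_def U_1 ev_1 mem_Collect_eq simp_thms) (metis imageI)
    fix x y assume xy: "x \<in> S" "y \<in> S"
    then obtain x' y' where xy': "x' \<in> carrier ?D\<^sub>0" "?U x = k\<^sub>0 x'" "y' \<in> carrier ?D\<^sub>0" "?U y = k\<^sub>0 y'"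
      unfolding S_def by blast
    then have "?U (x * y) = k\<^sub>0 (x' \<otimes>\<^bsub>?D\<^sub>0\<^esub> y')" by (simp only: U_mult k\<^sub>0.hom_mult)
    moreover have "x' \<otimes>\<^bsub>?D\<^sub>0\<^esub> y' \<in> carrier ?D\<^sub>0" using xy' by (intro D\<^sub>0.m_closed)
    ultimately show "x * y \<in> S" using xy by (simp add: S_def)
  next
    show "1 + 4 * v\<^sub>0 \<in> S" unfolding S_def four mem_Collect_eq
      using g\<^sub>1_im k\<^sub>1_im ev1[of "2 * v\<^sub>0"] unfolding g\<^sub>1_def four by blast
    fix i assume i: "i \<in> {..<l}"
    show "1 + 2 * lift_basis i \<in> S"
    proof (cases i)
      case 0
      then show ?thesis using g\<^sub>0_im ev1 by (simp only: S_def g\<^sub>0_def mem_Collect_eq simp_thms)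
    next
      case (Suc j)
      then have "g j \<in> k\<^sub>0 ` carrier ?D\<^sub>0" using i g_im[of j] k\<^sub>1_im by auto
      then show ?thesis using ev1 by (simp only: Suc S_def g_def mem_Collect_eq simp_thms)
    qed
  next
    fix h assume "h \<in> S"
    then have "ev h = ev 1" by (simp add: S_def)
    then show "two_pow_cong f 1 h 1" unfolding ev_eq_iff .
  next
    show "two_pow_cong f 1 p 1" using p unfolding ev_eq_iff[symmetric] by simp
  qed (use v\<^sub>0 lift_basis_span in auto)
  have surj: "k ` carrier ?D = carrier G"
  proof
    show "k ` carrier ?D \<subseteq> carrier G" using hom_k by (auto simp: hom_def Pi_iff)
    show "carrier G \<subseteq> k ` carrier ?D"
    proof
      fix u assume u: "u \<in> carrier G"
      then obtain p where p: "u = ?U p"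
        using R.Units_closed by (auto simp: G_def units_of_carrier carrier_galois_ring)
      have evp: "ev p \<noteq> \<zero>" using u Units_galois_ring[OF n1] by (simp add: p G_def units_of_carrier)
      then have evp': "ev p \<in> carrier (units_of F)" by (simp add: units_of_carrier F.field_Units)
      then have t: "teichmueller n (ev p) \<in> carrier G" using hom_teich by (auto simp: hom_def Pi_iff)
      define u' where "u' = inv\<^bsub>G\<^esub> (teichmueller n (ev p)) \<otimes>\<^bsub>G\<^esub> u"
      have u': "u' \<in> carrier G" "u = teichmueller n (ev p) \<otimes>\<^bsub>G\<^esub> u'"
        using t u by (simp_all add: u'_def G.m_assoc[symmetric])
      obtain q where q: "u' = ?U q"
        using R.Units_closed u'(1) by (auto simp: G_def units_of_carrier carrier_galois_ring)
      have "?U p = ?U (p ^ 2 ^ (l * n) * q)"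
        using u'(2) by (simp only: p q teichmueller_ev[OF n1] U_mult)
      then have "ev p = ev (p ^ 2 ^ (l * n) * q)"
        unfolding galois_proj_eq_iff ev_eq_iff using two_pow_cong_antimono[OF n1] by blast
      then have "ev p \<otimes> ev q = ev p \<otimes> \<one>" by (simp add: frobenius_power)
      then have "ev q = \<one>" using F.m_lcancel[OF evp, of "ev q" \<one>] by auto
      then obtain s where s: "s \<in> S" "two_pow_cong f (Suc (n - 1)) q s"
        using S_approx by blast
      then have "u' = ?U s" using n1 by (simp add: q galois_proj_eq_iff)
      then obtain d where "d \<in> carrier ?D\<^sub>0" "u' = k\<^sub>0 d" using s(1) by (auto simp: S_def)
      then show "u \<in> k ` carrier ?D"
        using u'(2) evp' by (intro image_eqI[of _ _ "(ev p, d)"]) (auto simp: k_def)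
    qed
  qed
  have "order ?D = (2 ^ l - 1) * (2 * (2 ^ (n - 2) * (2 ^ (n - 1)) ^ (l - 1)))"
  proof -
    have "order (units_of F) = 2 ^ l - 1"
      using finite_residue_field
      by (simp add: Coset.order_def units_of_carrier F.field_Units card_residue_field card_Diff_singleton)
    then show ?thesis
      by (simp only: order_DirProd order_group_power order_integer_mod_group zero_less_power zero_less_numeral)
  qed
  also have "2 * (2 ^ (n - 2) * (2 ^ (n - 1)) ^ (l - 1)) = (2::nat) ^ ((n - 1) * l)"
  proof -
    obtain m where m: "n = Suc (Suc m)" using n by (metis add_2_eq_Suc le_Suc_ex)
    obtain j where j: "l = Suc j" using degree_pos gr0_implies_Suc by blast
    show ?thesis unfolding m j by (simp add: power_add power_mult)
  qed
  finally have ord: "order ?D = order G"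
    using card_Units_galois_ring[OF n1] by (simp add: Coset.order_def G_def units_of_carrier)
  have "order G > 0"
    using finite_galois_ring R.Units_closed R.Units_one_closed
    by (auto simp: Coset.order_def G_def units_of_carrier card_gt_0_iff intro: finite_subset)
  then have "finite (carrier ?D)" using ord by (metis Coset.order_def card_ge_0_finite)
  then have "k \<in> iso ?D G" by (intro iso_of_surj_hom_card hom_k surj ord)
  then show ?thesis unfolding G_def by (rule is_isoI)
qed

end

section \<open>The local ring with the prescribed unit group\<close>

lemma (in comm_group) pow_group_exponent:
  assumes "finite (carrier G)" "x \<in> carrier G"
  shows "x [^] group_exponent G = \<one>"
proof -
  let ?Q = "\<lambda>n::nat. 0 < n \<and> (\<forall>x\<in>carrier G. x [^] n = \<one>)"
  have "?Q (order G)"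
    using assms(1) by (auto simp: Coset.order_def card_gt_0_iff intro: pow_order_eq_1[unfolded Coset.order_def])
  then have "?Q (LEAST n. ?Q n)" by (rule LeastI[of ?Q])
  then show ?thesis using assms(2) unfolding group_exponent_def by blast
qed

context int_poly_residue
begin

lemma finsum_galois_basis:
  assumes "\<And>i. i < m \<Longrightarrow> c i \<ge> 0"
  shows "finsum (galois_ring f n)
      (\<lambda>i. [(c i :: int)] \<cdot>\<^bsub>galois_ring f n\<^esub> galois_proj f n (Polynomial.monom 1 i)) {..<m}
    = galois_proj f n (poly_of_coeffs m c)"
proof -
  interpret R: cring "galois_ring f n" by (rule cring_galois_ring)
  show ?thesis using assms
  proof (induction m)
    case 0
    show ?case by (simp add: poly_of_coeffs_def galois_proj_0)
  next
    case (Suc m)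
    have "[(c m)] \<cdot>\<^bsub>galois_ring f n\<^esub> galois_proj f n (Polynomial.monom 1 m) =
        galois_proj f n (Polynomial.monom (c m) m)"
      using Suc(2)[of m] by (simp add: galois_proj_add_pow of_int_poly smult_monom)
    then show ?case
      using Suc by (simp add: lessThan_Suc poly_of_coeffs_def galois_proj_add R.a_comm)
  qed
qed

text \<open>The powers of the variable form a basis over the integers modulo \<open>2 ^ n\<close>.\<close>

lemma bij_betw_galois_basis:
  "bij_betw (\<lambda>c. finsum (galois_ring f n)
      (\<lambda>i. [(c i :: int)] \<cdot>\<^bsub>galois_ring f n\<^esub> galois_proj f n (Polynomial.monom 1 i)) {..<l})
    ({..<l} \<rightarrow>\<^sub>E {0..<2 ^ n}) (carrier (galois_ring f n))"
proof -
  have "bij_betw (galois_proj f n \<circ> poly_of_coeffs l) ({..<l} \<rightarrow>\<^sub>E {0..<2 ^ n})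
      (carrier (galois_ring f n))"
    by (rule bij_betw_trans[OF bij_betw_normal_forms bij_betw_galois_proj])
  then show ?thesis
  proof (rule bij_betw_cong[THEN iffD1, rotated])
    fix c assume "c \<in> {..<l} \<rightarrow>\<^sub>E {0..<2 ^ n :: int}"
    then show "(galois_proj f n \<circ> poly_of_coeffs l) c = finsum (galois_ring f n)
      (\<lambda>i. [(c i :: int)] \<cdot>\<^bsub>galois_ring f n\<^esub> galois_proj f n (Polynomial.monom 1 i)) {..<l}"
      by (subst finsum_galois_basis) (auto simp: PiE_iff)
  qed
qed

lemma galois_ring_exponent:
  assumes "x \<in> carrier (galois_ring f n)"
  shows "[((2::nat) ^ n)] \<cdot>\<^bsub>galois_ring f n\<^esub> x = \<zero>\<^bsub>galois_ring f n\<^esub>"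
proof -
  obtain p where p: "x = galois_proj f n p" using assms by (auto simp: carrier_galois_ring)
  have "two_pow_cong f n (of_nat (2 ^ n) * p) 0" by (simp add: two_pow_cong_def two_pow_mem)
  then show ?thesis
    by (simp only: p galois_proj_add_pow_nat galois_proj_0[symmetric] galois_proj_eq_iff)
qed

end

theorem proposition4p8:
  fixes P :: "('p, 'm) monoid_scheme"
    and F :: "('f, 'k) ring_scheme"
    and a a0 l :: nat
  assumes "comm_group P" and "finite (carrier P)" and "\<exists>k::nat. order P = 2 ^ k"
    and "group_exponent P = 2 ^ a"
    and "a0 \<ge> 1" and "int a0 \<ge> int a - 1" and "l \<ge> 1"
    and "field F" and "order F = 2 ^ l"
  shows "\<exists>A :: nat ring. local_cring A \<and> artinian_cring A \<and>
    units_of A \<cong> units_of F \<times>\<times> integer_mod_group 2 \<times>\<times> integer_mod_group (2 ^ (a0 - 1))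
      \<times>\<times> group_power (integer_mod_group (2 ^ a0)) (l - 1) \<times>\<times> group_power P l"
proof -
  interpret P: comm_group P by fact
  interpret F: field F by fact
  obtain f ev where "int_poly_residue F f ev"
    using F.ex_int_poly_residue[OF \<open>order F = 2 ^ l\<close>] by blast
  then interpret res: int_poly_residue F f ev .
  have "(2::nat) ^ Polynomial.degree f = 2 ^ l"
    using \<open>order F = 2 ^ l\<close> by (simp add: Coset.order_def res.card_residue_field)
  then have deg: "Polynomial.degree f = l" by simp
  \<comment> \<open>The largest cyclic factors of the group of principal units then have order at most \<open>2 ^ a0\<close>, and
    \<open>2 ^ n\<close> kills \<open>P\<close> because \<open>a \<le> a0 + 1\<close>.\<close>
  define n where "n = a0 + 1"
  have n: "n \<ge> 1" "n \<ge> 2" using \<open>a0 \<ge> 1\<close> by (simp_all add: n_def)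
  define R where "R = galois_ring f n"
  interpret R: cring R unfolding R_def by (rule cring_galois_ring)
  interpret RP: ring_and_group R P ..
  let ?H = "hom_group R P" and ?A = "hom_idealization R P"
  interpret A: cring ?A by (rule RP.cring_hom_idealization)
  interpret H: comm_group ?H by (rule RP.comm_group_hom_group)
  have P_exp: "y [^]\<^bsub>P\<^esub> ((2::nat) ^ n) = \<one>\<^bsub>P\<^esub>" if "y \<in> carrier P" for y
  proof -
    have "a \<le> n" using \<open>int a0 \<ge> int a - 1\<close> by (simp add: n_def)
    then have "(2::nat) ^ n = 2 ^ a * 2 ^ (n - a)" by (simp flip: power_add)
    moreover have "y [^]\<^bsub>P\<^esub> ((2::nat) ^ a) = \<one>\<^bsub>P\<^esub>"
      using P.pow_group_exponent[OF \<open>finite (carrier P)\<close> that] \<open>group_exponent P = 2 ^ a\<close> by simp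
    ultimately show ?thesis using that by (simp flip: P.nat_pow_pow)
  qed
  have H_iso: "?H \<cong> group_power P l"
  proof (rule RP.hom_group_free_iso[where N = "2 ^ n" and e = "\<lambda>i. galois_proj f n (Polynomial.monom 1 i)"])
    show "bij_betw (\<lambda>c. finsum R (\<lambda>i. [(c i :: int)] \<cdot>\<^bsub>R\<^esub> galois_proj f n (Polynomial.monom 1 i)) {..<l})
        ({..<l} \<rightarrow>\<^sub>E {0..<int (2 ^ n)}) (carrier R)"
      using res.bij_betw_galois_basis[of n] by (simp add: R_def deg)
    show "(1::nat) < 2 ^ n" using n(1) by (intro one_less_power) simp_all
  qed (use n P_exp res.galois_ring_exponent in \<open>auto simp: R_def\<close>)
  have finite_A: "finite (carrier ?A)"
  proof -
    have "finite (carrier (group_power P l))"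
      using \<open>finite (carrier P)\<close> by (auto simp: group_power_def intro: finite_PiE)
    then have "finite (carrier ?H)"
      using H_iso unfolding is_iso_def iso_def by (auto simp: bij_betw_finite)
    moreover have "finite (carrier R)" unfolding R_def by (rule res.finite_galois_ring)
    ultimately show ?thesis by (simp add: RP.carrier_hom_idealization)
  qed
  have res_hom: "res.residue n \<in> ring_hom R F" unfolding R_def by (rule res.residue_hom[OF n(1)])
  have \<sigma>: "res.residue n \<circ> fst \<in> ring_hom ?A F"
    using ring_hom_closed[OF res_hom] ring_hom_mult[OF res_hom] ring_hom_add[OF res_hom]
      ring_hom_one[OF res_hom]
    by (intro ring_hom_memI) (auto simp: RP.hom_idealization_simps)
  have units: "x \<in> Units ?A" if x: "x \<in> carrier ?A" "(res.residue n \<circ> fst) x \<noteq> \<zero>\<^bsub>F\<^esub>" for x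
  proof -
    obtain r \<phi> where r: "x = (r, \<phi>)" "r \<in> carrier R" "\<phi> \<in> carrier ?H"
      using x(1) by (auto simp: RP.carrier_hom_idealization)
    obtain p where p: "r = galois_proj f n p"
      using r(2) unfolding R_def carrier_galois_ring by blast
    have "ev p \<noteq> \<zero>\<^bsub>F\<^esub>" using x(2) by (simp add: r p res.residue_galois_proj[OF n(1)])
    then have "r \<in> Units R" by (simp add: p R_def res.Units_galois_ring[OF n(1)])
    then show ?thesis using r by (simp add: RP.Units_hom_idealization)
  qed
  obtain B :: "nat ring" where B: "local_cring B" "artinian_cring B" "units_of ?A \<cong> units_of B"
    using finite_local_ring_nat_copy[OF A.cring_axioms finite_A \<open>field F\<close> \<sigma> units] by blast
  let ?D = "units_of F \<times>\<times> integer_mod_group 2 \<times>\<times> integer_mod_group (2 ^ (a0 - 1))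
      \<times>\<times> group_power (integer_mod_group (2 ^ a0)) (l - 1)"
  interpret D: group ?D
    by (intro DirProd_group F.units_group) (simp_all add: group_power_def)
  have D_iso: "?D \<cong> units_of R"
    using res.units_galois_ring_iso[OF n(2)] by (simp add: R_def deg n_def)
  interpret T: group "?D \<times>\<times> group_power P l"
    by (intro DirProd_group D.is_group) (simp add: group_power_def P.is_group)
  have "group_power P l \<cong> ?H" by (rule H.iso_sym[OF H_iso])
  with D_iso have "?D \<times>\<times> group_power P l \<cong> units_of R \<times>\<times> ?H"
    by (rule D.DirProd_iso_trans)
  also have "units_of R \<times>\<times> ?H \<cong> units_of ?A" by (rule RP.units_hom_idealization_iso)
  also note B(3)
  finally have "units_of B \<cong> ?D \<times>\<times> group_power P l" by (rule T.iso_sym)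
  \<comment> \<open>The left bracketing of the product is undone.\<close>
  also have "?D \<times>\<times> group_power P l \<cong> units_of F \<times>\<times> integer_mod_group 2 \<times>\<times> integer_mod_group (2 ^ (a0 - 1))
      \<times>\<times> group_power (integer_mod_group (2 ^ a0)) (l - 1) \<times>\<times> group_power P l"
    by (rule is_isoI[where h = "\<lambda>((u, x, y, z), w). (u, x, y, z, w)"])
       (auto simp: iso_def hom_def bij_betw_def inj_on_def image_iff)
  finally show ?thesis using B by blast
qed

end
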